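(* Let $\mathcal{S}$ be a small category with subcategories $\mathcal{S}^{sm}$ (smooth morphisms) and $\mathcal{S}^{cl}$ (closed immersions) satisfying conditions (i)--(iv) listed in the context. Let $\mathbb{H}_1,\mathbb{H}_2$ be $\mathcal{S}$-fibered categories and let $\mathcal{R}=\{R_S:\mathbb{H}_1(S)\to\mathbb{H}_2(S)\}_{S\in\mathcal{S}}$ be a family of functors. Then every $\mathcal{S}$-structure on $\mathcal{R}$ determines, by restriction to $\mathcal{S}^{sm}$ and $\mathcal{S}^{cl}$, an $\mathcal{S}$-skeleton on $\mathcal{R}$. Conversely, every $\mathcal{S}$-skeleton $(\theta^{sm},\theta^{cl})$ on $\mathcal{R}$ extends uniquely to an $\mathcal{S}$-structure on $\mathcal{R}$ (i.e. there is a unique $\mathcal{S}$-structure $\theta$ with $\theta_p=\theta^{sm}_p$ for $p$ in $\mathcal{S}^{sm}$ and $\theta_t=\theta^{cl}_t$ for $t$ in $\mathcal{S}^{cl}$). Moreover, if $\mathbb{H}_1$ and $\mathbb{H}_2$ are smooth-adjointable, then a given $\mathcal{S}$-structure on $\mathcal{R}$ is smooth-adjointable if and only if the underlying $\mathcal{S}$-skeleton is smooth-adjointable.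
   Context: Standing assumptions on $\mathcal{S}$: $\mathcal{S}$ is a small category with two (possibly non-full) subcategories $\mathcal{S}^{sm},\mathcal{S}^{cl}$ such that: (i) both have the same objects as $\mathcal{S}$ and contain all isomorphisms; (ii) for every $p:P\to S$ in $\mathcal{S}^{sm}$ and every $f:T\to S$ in $\mathcal{S}$ the fibered product $P\times_S T$ exists, and in every Cartesian square with $p$ in $\mathcal{S}^{sm}$ the base change $p':P_T\to T$ of $p$ along $f$ belongs to $\mathcal{S}^{sm}$; (iii) in every Cartesian square with sides $z':P_Z\to P$, $p':P_Z\to Z$, $p:P\to S$ in $\mathcal{S}^{sm}$ and $z:Z\to S$ in $\mathcal{S}^{cl}$, the morphism $z'$ belongs to $\mathcal{S}^{cl}$; moreover if $z:Z\to S$ and $g:S\to V$ are morphisms of $\mathcal{S}$ with $gz$ in $\mathcal{S}^{cl}$, then $z$ is in $\mathcal{S}^{cl}$; (iv) every morphism $f$ of $\mathcal{S}$ factors as $f=p\circ t$ with $t$ in $\mathcal{S}^{cl}$ and $p$ in $\mathcal{S}^{sm}$. Morphisms in $\mathcal{S}^{sm}$ are called smooth, morphisms in $\mathcal{S}^{cl}$ closed immersions. An $\mathcal{S}$-fibered category $\mathbb{H}$ consists of a category $\mathbb{H}(S)$ for each $S\in\mathcal{S}$, a functor $f^*:\mathbb{H}(S)\to\mathbb{H}(T)$ for each $f:T\to S$, and natural isomorphisms $\mathrm{conn}_{f,g}:(gf)^*A\xrightarrow{\sim}f^*g^*A$ (connection isomorphisms) for composable $f:T\to S$, $g:S\to V$,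 such that $\mathrm{id}_S^*=\mathrm{id}_{\mathbb{H}(S)}$ and, for composable $f,g,h$, $f^*\mathrm{conn}_{g,h}\circ\mathrm{conn}_{f,hg}=\mathrm{conn}_{f,g}\circ\mathrm{conn}_{gf,h}:(hgf)^*A\to f^*g^*h^*A$. Composites of connection isomorphisms are coherent and are written as equalities. $\mathbb{H}$ restricts to an $\mathcal{S}'$-fibered category for every subcategory $\mathcal{S}'$. For $\mathcal{S}'\subseteq\mathcal{S}$ (e.g. $\mathcal{S},\mathcal{S}^{sm},\mathcal{S}^{cl}$), an $\mathcal{S}'$-structure $\theta$ on $\mathcal{R}$ is a system of natural isomorphisms $\theta_f:f^*R_S(A)\xrightarrow{\sim}R_T(f^*A)$ for $f:T\to S$ in $\mathcal{S}'$, such that for composable $f:T\to S$, $g:S\to V$ in $\mathcal{S}'$ one has, modulo $(gf)^*=f^*g^*$, $\theta_{gf}=\theta_f\circ f^*\theta_g: f^*g^*R_V(A)\to f^*R_S(g^*A)\to R_T(f^*g^*A)$. An $\mathcal{S}$-skeleton $(\theta^{sm},\theta^{cl})$ on $\mathcal{R}$ is an $\mathcal{S}^{sm}$-structure $\theta^{sm}$ and an $\mathcal{S}^{cl}$-structure $\theta^{cl}$ on $\mathcal{R}$ such that for every commutative square $p\circ h=z\circ q$ with $h:Q\to P$, $q:Q\to Z$, $p:P\to S$, $z:Z\to S$, where $p,q$ are smooth and $z,h$ closed immersions, the two composites $$q^*z^*R_S(A)\xrightarrow{\theta^{cl}_z}q^*R_Z(z^*A)\xrightarrow{\theta^{sm}_q}R_Q(q^*z^*A),\qquad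 h^*p^*R_S(A)\xrightarrow{\theta^{sm}_p}h^*R_P(p^*A)\xrightarrow{\theta^{cl}_h}R_Q(h^*p^*A)$$ coincide modulo $q^*z^*=h^*p^*$. $\mathbb{H}$ is smooth-adjointable if $p^*$ has a left adjoint $p_\#$ for every smooth $p$. When $\mathbb{H}_1,\mathbb{H}_2$ are smooth-adjointable, an $\mathcal{S}$-structure (or an $\mathcal{S}^{sm}$-structure) $\theta$ on $\mathcal{R}$ is smooth-adjointable (or left-adjointable) if for every smooth $p:P\to S$ the composite $p_\#R_P(A)\xrightarrow{\eta}p_\#R_P(p^*p_\#A)\xrightarrow{\theta_p^{-1}}p_\#p^*R_S(p_\#A)\xrightarrow{\epsilon}R_S(p_\#A)$ is invertible; a skeleton $(\theta^{sm},\theta^{cl})$ is smooth-adjointable if $\theta^{sm}$ is left-adjointable. Here $\eta,\epsilon$ denote units and counits. *)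

theory Defs
  imports "HOL-Library.FuncSet"
begin

section \<open>Categories, functors, natural transformations\<close>

text \<open>
  Objects and arrows are carrier sets inside HOL types, so every category here is small.
  The operations are only meaningful on the carriers; \<open>g \<cdot> f\<close> means ``first \<open>f\<close>, then \<open>g\<close>''.
\<close>

record ('o, 'm) cat =
  Obj :: "'o set"
  Arr :: "'m set"
  Dom :: "'m \<Rightarrow> 'o"
  Cod :: "'m \<Rightarrow> 'o"
  Ide :: "'o \<Rightarrow> 'm"
  Cmp :: "'m \<Rightarrow> 'm \<Rightarrow> 'm"  (infixl "\<cdot>\<index>" 70)

definition hom :: "('o, 'm) cat \<Rightarrow> 'o \<Rightarrow> 'o \<Rightarrow> 'm set" where
  "hom C A B = {f \<in> Arr C. Dom C f = A \<and> Cod C f = B}"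

locale category =
  fixes C :: "('o, 'm) cat" (structure)
  assumes Dom_closed: "f \<in> Arr C \<Longrightarrow> Dom C f \<in> Obj C"
    and Cod_closed: "f \<in> Arr C \<Longrightarrow> Cod C f \<in> Obj C"
    and Ide_hom: "A \<in> Obj C \<Longrightarrow> Ide C A \<in> hom C A A"
    and Cmp_hom: "f \<in> Arr C \<Longrightarrow> g \<in> Arr C \<Longrightarrow> Cod C f = Dom C g
                    \<Longrightarrow> g \<cdot> f \<in> hom C (Dom C f) (Cod C g)"
    and Ide_left: "f \<in> Arr C \<Longrightarrow> Ide C (Cod C f) \<cdot> f = f"
    and Ide_right: "f \<in> Arr C \<Longrightarrow> f \<cdot> Ide C (Dom C f) = f"
    and Cmp_assoc: "f \<in> Arr C \<Longrightarrow> g \<in> Arr C \<Longrightarrow> h \<in> Arr C \<Longrightarrow> Cod C f = Dom C g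
                    \<Longrightarrow> Cod C g = Dom C h \<Longrightarrow> (h \<cdot> g) \<cdot> f = h \<cdot> (g \<cdot> f)"

definition inverse_arrows :: "('o, 'm) cat \<Rightarrow> 'm \<Rightarrow> 'm \<Rightarrow> bool" where
  "inverse_arrows C f g \<longleftrightarrow>
     f \<in> Arr C \<and> g \<in> hom C (Cod C f) (Dom C f) \<and>
     g \<cdot>\<^bsub>C\<^esub> f = Ide C (Dom C f) \<and> f \<cdot>\<^bsub>C\<^esub> g = Ide C (Cod C f)"

definition iso_arr :: "('o, 'm) cat \<Rightarrow> 'm \<Rightarrow> bool" where
  "iso_arr C f \<longleftrightarrow> (\<exists>g. inverse_arrows C f g)"

definition inv_arr :: "('o, 'm) cat \<Rightarrow> 'm \<Rightarrow> 'm" where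
  "inv_arr C f = (THE g. inverse_arrows C f g)"

definition subcategory :: "('o, 'm) cat \<Rightarrow> ('o, 'm) cat \<Rightarrow> bool" where
  "subcategory D C \<longleftrightarrow>
     category D \<and> Obj D \<subseteq> Obj C \<and> Arr D \<subseteq> Arr C \<and>
     (\<forall>f\<in>Arr D. Dom D f = Dom C f \<and> Cod D f = Cod C f) \<and>
     (\<forall>A\<in>Obj D. Ide D A = Ide C A) \<and>
     (\<forall>f\<in>Arr D. \<forall>g\<in>Arr D. Cod D f = Dom D g \<longrightarrow> g \<cdot>\<^bsub>D\<^esub> f = g \<cdot>\<^bsub>C\<^esub> f)"

text \<open>
  \<open>cartesian_square C p f p' f'\<close>: the square \<open>p \<cdot> f' = f \<cdot> p'\<close> is Cartesian, i.e. \<open>p'\<close> is a base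
  change of \<open>p\<close> along \<open>f\<close> and \<open>f'\<close> is a base change of \<open>f\<close> along \<open>p\<close>.
\<close>

definition cartesian_square :: "('o, 'm) cat \<Rightarrow> 'm \<Rightarrow> 'm \<Rightarrow> 'm \<Rightarrow> 'm \<Rightarrow> bool" where
  "cartesian_square C p f p' f' \<longleftrightarrow>
     p \<in> Arr C \<and> f \<in> Arr C \<and> p' \<in> Arr C \<and> f' \<in> Arr C \<and>
     Cod C p = Cod C f \<and> Cod C p' = Dom C f \<and> Cod C f' = Dom C p \<and> Dom C p' = Dom C f' \<and>
     p \<cdot>\<^bsub>C\<^esub> f' = f \<cdot>\<^bsub>C\<^esub> p' \<and>
     (\<forall>X\<in>Obj C. \<forall>u\<in>hom C X (Dom C p). \<forall>v\<in>hom C X (Dom C f).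
        p \<cdot>\<^bsub>C\<^esub> u = f \<cdot>\<^bsub>C\<^esub> v \<longrightarrow>
        (\<exists>!w. w \<in> hom C X (Dom C p') \<and> f' \<cdot>\<^bsub>C\<^esub> w = u \<and> p' \<cdot>\<^bsub>C\<^esub> w = v))"

record ('o1, 'm1, 'o2, 'm2) ftor =
  on_obj :: "'o1 \<Rightarrow> 'o2"
  on_arr :: "'m1 \<Rightarrow> 'm2"

definition is_functor ::
  "('o1, 'm1) cat \<Rightarrow> ('o2, 'm2) cat \<Rightarrow> ('o1, 'm1, 'o2, 'm2) ftor \<Rightarrow> bool" where
  "is_functor C D F \<longleftrightarrow>
     category C \<and> category D \<and>
     (\<forall>A\<in>Obj C. on_obj F A \<in> Obj D) \<and>
     (\<forall>f\<in>Arr C. on_arr F f \<in> hom D (on_obj F (Dom C f)) (on_obj F (Cod C f))) \<and>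
     (\<forall>A\<in>Obj C. on_arr F (Ide C A) = Ide D (on_obj F A)) \<and>
     (\<forall>f\<in>Arr C. \<forall>g\<in>Arr C. Cod C f = Dom C g \<longrightarrow>
        on_arr F (g \<cdot>\<^bsub>C\<^esub> f) = on_arr F g \<cdot>\<^bsub>D\<^esub> on_arr F f)"

definition id_ftor :: "('o, 'm, 'o, 'm) ftor" where
  "id_ftor = \<lparr>on_obj = (\<lambda>A. A), on_arr = (\<lambda>f. f)\<rparr>"

definition comp_ftor ::
  "('o2, 'm2, 'o3, 'm3) ftor \<Rightarrow> ('o1, 'm1, 'o2, 'm2) ftor \<Rightarrow> ('o1, 'm1, 'o3, 'm3) ftor"
  (infixl "\<odot>" 75) where
  "G \<odot> F = \<lparr>on_obj = (\<lambda>A. on_obj G (on_obj F A)), on_arr = (\<lambda>f. on_arr G (on_arr F f))\<rparr>"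

definition nat_trans ::
  "('o1, 'm1) cat \<Rightarrow> ('o2, 'm2) cat \<Rightarrow> ('o1, 'm1, 'o2, 'm2) ftor \<Rightarrow> ('o1, 'm1, 'o2, 'm2) ftor
     \<Rightarrow> ('o1 \<Rightarrow> 'm2) \<Rightarrow> bool" where
  "nat_trans C D F G \<tau> \<longleftrightarrow>
     (\<forall>A\<in>Obj C. \<tau> A \<in> hom D (on_obj F A) (on_obj G A)) \<and>
     (\<forall>f\<in>Arr C. \<tau> (Cod C f) \<cdot>\<^bsub>D\<^esub> on_arr F f = on_arr G f \<cdot>\<^bsub>D\<^esub> \<tau> (Dom C f))"

definition nat_iso ::
  "('o1, 'm1) cat \<Rightarrow> ('o2, 'm2) cat \<Rightarrow> ('o1, 'm1, 'o2, 'm2) ftor \<Rightarrow> ('o1, 'm1, 'o2, 'm2) ftor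
     \<Rightarrow> ('o1 \<Rightarrow> 'm2) \<Rightarrow> bool" where
  "nat_iso C D F G \<tau> \<longleftrightarrow> nat_trans C D F G \<tau> \<and> (\<forall>A\<in>Obj C. iso_arr D (\<tau> A))"

text \<open>A left adjoint of a functor, packaged with the unit and counit of the adjunction.\<close>

record ('o1, 'm1, 'o2, 'm2) left_adj =
  ladj :: "('o1, 'm1, 'o2, 'm2) ftor"
  unit :: "'o1 \<Rightarrow> 'm1"
  counit :: "'o2 \<Rightarrow> 'm2"

definition is_left_adjoint ::
  "('o1, 'm1) cat \<Rightarrow> ('o2, 'm2) cat \<Rightarrow> ('o2, 'm2, 'o1, 'm1) ftor
     \<Rightarrow> ('o1, 'm1, 'o2, 'm2) left_adj \<Rightarrow> bool" where
  "is_left_adjoint C D G L \<longleftrightarrow>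
     is_functor D C G \<and> is_functor C D (ladj L) \<and>
     nat_trans C C id_ftor (G \<odot> ladj L) (unit L) \<and>
     nat_trans D D (ladj L \<odot> G) id_ftor (counit L) \<and>
     (\<forall>A\<in>Obj C. counit L (on_obj (ladj L) A) \<cdot>\<^bsub>D\<^esub> on_arr (ladj L) (unit L A)
                = Ide D (on_obj (ladj L) A)) \<and>
     (\<forall>B\<in>Obj D. on_arr G (counit L B) \<cdot>\<^bsub>C\<^esub> unit L (on_obj G B) = Ide C (on_obj G B))"


section \<open>Smooth morphisms and closed immersions\<close>

definition smooth_closed_base ::
  "('s, 'f) cat \<Rightarrow> ('s, 'f) cat \<Rightarrow> ('s, 'f) cat \<Rightarrow> bool" where
  "smooth_closed_base S Sm Cl \<longleftrightarrow>
     category S \<and> subcategory Sm S \<and> subcategory Cl S \<and>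
     Obj Sm = Obj S \<and> Obj Cl = Obj S \<and>
     (\<forall>f. iso_arr S f \<longrightarrow> f \<in> Arr Sm \<and> f \<in> Arr Cl) \<and>
     (\<forall>p\<in>Arr Sm. \<forall>f\<in>Arr S. Cod S f = Cod S p \<longrightarrow> (\<exists>p' f'. cartesian_square S p f p' f')) \<and>
     (\<forall>p f p' f'. cartesian_square S p f p' f' \<and> p \<in> Arr Sm \<longrightarrow> p' \<in> Arr Sm) \<and>
     (\<forall>p z p' z'. cartesian_square S p z p' z' \<and> p \<in> Arr Sm \<and> z \<in> Arr Cl \<longrightarrow> z' \<in> Arr Cl) \<and>
     (\<forall>z\<in>Arr S. \<forall>g\<in>Arr S. Cod S z = Dom S g \<and> g \<cdot>\<^bsub>S\<^esub> z \<in> Arr Cl \<longrightarrow> z \<in> Arr Cl) \<and>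
     (\<forall>f\<in>Arr S. \<exists>t\<in>Arr Cl. \<exists>p\<in>Arr Sm. Cod S t = Dom S p \<and> f = p \<cdot>\<^bsub>S\<^esub> t)"


section \<open>Fibered categories\<close>

text \<open>
  \<open>Fib H S\<close> is the fibre over \<open>S\<close>, \<open>Pull H f\<close> the functor \<open>f\<^sup>*\<close>, and
  \<open>Conn H f g A\<close> the connection isomorphism \<open>(g \<cdot> f)\<^sup>* A \<rightarrow> f\<^sup>* (g\<^sup>* A)\<close>.
\<close>

record ('s, 'f, 'o, 'm) fibcat =
  Fib :: "'s \<Rightarrow> ('o, 'm) cat"
  Pull :: "'f \<Rightarrow> ('o, 'm, 'o, 'm) ftor"
  Conn :: "'f \<Rightarrow> 'f \<Rightarrow> 'o \<Rightarrow> 'm"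

locale fibered_category = base: category S
  for S :: "('s, 'f) cat" (structure) and H :: "('s, 'f, 'o, 'm) fibcat" +
  assumes Fib_category: "X \<in> Obj S \<Longrightarrow> category (Fib H X)"
    and Pull_functor: "f \<in> Arr S \<Longrightarrow> is_functor (Fib H (Cod S f)) (Fib H (Dom S f)) (Pull H f)"
    and Pull_Ide_obj: "X \<in> Obj S \<Longrightarrow> A \<in> Obj (Fib H X) \<Longrightarrow> on_obj (Pull H (Ide S X)) A = A"
    and Pull_Ide_arr: "X \<in> Obj S \<Longrightarrow> a \<in> Arr (Fib H X) \<Longrightarrow> on_arr (Pull H (Ide S X)) a = a"
    and Conn_nat_iso: "f \<in> Arr S \<Longrightarrow> g \<in> Arr S \<Longrightarrow> Cod S f = Dom S g \<Longrightarrow>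
           nat_iso (Fib H (Cod S g)) (Fib H (Dom S f))
             (Pull H (g \<cdot> f)) (Pull H f \<odot> Pull H g) (Conn H f g)"
    and Conn_cocycle: "f \<in> Arr S \<Longrightarrow> g \<in> Arr S \<Longrightarrow> h \<in> Arr S \<Longrightarrow>
           Cod S f = Dom S g \<Longrightarrow> Cod S g = Dom S h \<Longrightarrow> A \<in> Obj (Fib H (Cod S h)) \<Longrightarrow>
           on_arr (Pull H f) (Conn H g h A) \<cdot>\<^bsub>Fib H (Dom S f)\<^esub> Conn H f (h \<cdot> g) A
           = Conn H f g (on_obj (Pull H h) A) \<cdot>\<^bsub>Fib H (Dom S f)\<^esub> Conn H (g \<cdot> f) h A"

text \<open>
  For a commutative square \<open>p \<cdot> h = z \<cdot> q\<close> in \<open>S\<close>, the identification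
  \<open>q\<^sup>* (z\<^sup>* A) \<rightarrow> h\<^sup>* (p\<^sup>* A)\<close> through \<open>(z \<cdot> q)\<^sup>* A = (p \<cdot> h)\<^sup>* A\<close>.
\<close>

definition square_conn ::
  "('s, 'f) cat \<Rightarrow> ('s, 'f, 'o, 'm) fibcat \<Rightarrow> 'f \<Rightarrow> 'f \<Rightarrow> 'f \<Rightarrow> 'f \<Rightarrow> 'o \<Rightarrow> 'm" where
  "square_conn S H q z h p A =
     Conn H h p A \<cdot>\<^bsub>Fib H (Dom S q)\<^esub> inv_arr (Fib H (Dom S q)) (Conn H q z A)"


section \<open>Structures and skeletons on a family of functors\<close>

definition functor_family ::
  "('s, 'f) cat \<Rightarrow> ('s, 'f, 'o1, 'm1) fibcat \<Rightarrow> ('s, 'f, 'o2, 'm2) fibcat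
     \<Rightarrow> ('s \<Rightarrow> ('o1, 'm1, 'o2, 'm2) ftor) \<Rightarrow> bool" where
  "functor_family S H1 H2 R \<longleftrightarrow> (\<forall>X\<in>Obj S. is_functor (Fib H1 X) (Fib H2 X) (R X))"

text \<open>
  \<open>is_structure S' H1 H2 R \<theta>\<close> is meant for a subcategory \<open>S'\<close> of the base of \<open>H1\<close> and \<open>H2\<close>.
  The two extensionality clauses fix the junk values of \<open>\<theta>\<close> outside its domain of definition, so
  that two structures are equal as HOL functions iff all their components agree.  In the last
  clause \<open>(g \<cdot> f)\<^sup>* = f\<^sup>* g\<^sup>*\<close> is made explicit by the connection isomorphisms of \<open>H1\<close> and \<open>H2\<close>.
\<close>

definition is_structure ::
  "('s, 'f) cat \<Rightarrow> ('s, 'f, 'o1, 'm1) fibcat \<Rightarrow> ('s, 'f, 'o2, 'm2) fibcat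
     \<Rightarrow> ('s \<Rightarrow> ('o1, 'm1, 'o2, 'm2) ftor) \<Rightarrow> ('f \<Rightarrow> 'o1 \<Rightarrow> 'm2) \<Rightarrow> bool" where
  "is_structure S' H1 H2 R \<theta> \<longleftrightarrow>
     \<theta> \<in> extensional (Arr S') \<and>
     (\<forall>f\<in>Arr S'. \<theta> f \<in> extensional (Obj (Fib H1 (Cod S' f)))) \<and>
     (\<forall>f\<in>Arr S'. nat_iso (Fib H1 (Cod S' f)) (Fib H2 (Dom S' f))
        (Pull H2 f \<odot> R (Cod S' f)) (R (Dom S' f) \<odot> Pull H1 f) (\<theta> f)) \<and>
     (\<forall>f\<in>Arr S'. \<forall>g\<in>Arr S'. Cod S' f = Dom S' g \<longrightarrow>
        (\<forall>A\<in>Obj (Fib H1 (Cod S' g)).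
           on_arr (R (Dom S' f)) (Conn H1 f g A) \<cdot>\<^bsub>Fib H2 (Dom S' f)\<^esub> \<theta> (g \<cdot>\<^bsub>S'\<^esub> f) A
           = \<theta> f (on_obj (Pull H1 g) A) \<cdot>\<^bsub>Fib H2 (Dom S' f)\<^esub> on_arr (Pull H2 f) (\<theta> g A)
               \<cdot>\<^bsub>Fib H2 (Dom S' f)\<^esub> Conn H2 f g (on_obj (R (Cod S' g)) A)))"

definition is_skeleton ::
  "('s, 'f) cat \<Rightarrow> ('s, 'f) cat \<Rightarrow> ('s, 'f) cat
     \<Rightarrow> ('s, 'f, 'o1, 'm1) fibcat \<Rightarrow> ('s, 'f, 'o2, 'm2) fibcat
     \<Rightarrow> ('s \<Rightarrow> ('o1, 'm1, 'o2, 'm2) ftor)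
     \<Rightarrow> ('f \<Rightarrow> 'o1 \<Rightarrow> 'm2) \<times> ('f \<Rightarrow> 'o1 \<Rightarrow> 'm2) \<Rightarrow> bool" where
  "is_skeleton S Sm Cl H1 H2 R = (\<lambda>(\<theta>sm, \<theta>cl).
     is_structure Sm H1 H2 R \<theta>sm \<and> is_structure Cl H1 H2 R \<theta>cl \<and>
     (\<forall>p\<in>Arr Sm. \<forall>q\<in>Arr Sm. \<forall>z\<in>Arr Cl. \<forall>h\<in>Arr Cl.
        Cod S h = Dom S p \<and> Cod S q = Dom S z \<and> p \<cdot>\<^bsub>S\<^esub> h = z \<cdot>\<^bsub>S\<^esub> q \<longrightarrow>
        (\<forall>A\<in>Obj (Fib H1 (Cod S z)).
           on_arr (R (Dom S q)) (square_conn S H1 q z h p A) \<cdot>\<^bsub>Fib H2 (Dom S q)\<^esub>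
             (\<theta>sm q (on_obj (Pull H1 z) A) \<cdot>\<^bsub>Fib H2 (Dom S q)\<^esub> on_arr (Pull H2 q) (\<theta>cl z A))
           = (\<theta>cl h (on_obj (Pull H1 p) A) \<cdot>\<^bsub>Fib H2 (Dom S q)\<^esub> on_arr (Pull H2 h) (\<theta>sm p A))
               \<cdot>\<^bsub>Fib H2 (Dom S q)\<^esub> square_conn S H2 q z h p (on_obj (R (Cod S z)) A))))"


section \<open>Smooth-adjointability\<close>

text \<open>
  \<open>smooth_adjointable Sm H L\<close>: \<open>H\<close> is smooth-adjointable, \<open>L p\<close> being a choice of left adjoint
  \<open>p\<^sub>#\<close> of \<open>p\<^sup>*\<close> for every smooth \<open>p\<close>.
\<close>

definition smooth_adjointable ::
  "('s, 'f) cat \<Rightarrow> ('s, 'f, 'o, 'm) fibcat \<Rightarrow> ('f \<Rightarrow> ('o, 'm, 'o, 'm) left_adj) \<Rightarrow> bool" where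
  "smooth_adjointable Sm H L \<longleftrightarrow>
     (\<forall>p\<in>Arr Sm. is_left_adjoint (Fib H (Dom Sm p)) (Fib H (Cod Sm p)) (Pull H p) (L p))"

text \<open>The composite \<open>p\<^sub># R\<^sub>P(A) \<rightarrow> p\<^sub># R\<^sub>P(p\<^sup>* p\<^sub># A) \<rightarrow> p\<^sub># p\<^sup>* R\<^sub>S(p\<^sub># A) \<rightarrow> R\<^sub>S(p\<^sub># A)\<close> for \<open>p : P \<rightarrow> S\<close>.\<close>

definition exchange ::
  "('s, 'f) cat \<Rightarrow> ('s, 'f, 'o2, 'm2) fibcat \<Rightarrow> ('s \<Rightarrow> ('o1, 'm1, 'o2, 'm2) ftor)
     \<Rightarrow> ('f \<Rightarrow> ('o1, 'm1, 'o1, 'm1) left_adj) \<Rightarrow> ('f \<Rightarrow> ('o2, 'm2, 'o2, 'm2) left_adj)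
     \<Rightarrow> ('f \<Rightarrow> 'o1 \<Rightarrow> 'm2) \<Rightarrow> 'f \<Rightarrow> 'o1 \<Rightarrow> 'm2" where
  "exchange Sm H2 R L1 L2 \<theta> p A =
     (let P = Dom Sm p; S = Cod Sm p; pA = on_obj (ladj (L1 p)) A in
        counit (L2 p) (on_obj (R S) pA)
        \<cdot>\<^bsub>Fib H2 S\<^esub> on_arr (ladj (L2 p)) (inv_arr (Fib H2 P) (\<theta> p pA))
        \<cdot>\<^bsub>Fib H2 S\<^esub> on_arr (ladj (L2 p)) (on_arr (R P) (unit (L1 p) A)))"

definition left_adjointable ::
  "('s, 'f) cat \<Rightarrow> ('s, 'f, 'o1, 'm1) fibcat \<Rightarrow> ('s, 'f, 'o2, 'm2) fibcat
     \<Rightarrow> ('s \<Rightarrow> ('o1, 'm1, 'o2, 'm2) ftor)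
     \<Rightarrow> ('f \<Rightarrow> ('o1, 'm1, 'o1, 'm1) left_adj) \<Rightarrow> ('f \<Rightarrow> ('o2, 'm2, 'o2, 'm2) left_adj)
     \<Rightarrow> ('f \<Rightarrow> 'o1 \<Rightarrow> 'm2) \<Rightarrow> bool" where
  "left_adjointable Sm H1 H2 R L1 L2 \<theta> \<longleftrightarrow>
     (\<forall>p\<in>Arr Sm. \<forall>A\<in>Obj (Fib H1 (Dom Sm p)).
        iso_arr (Fib H2 (Cod Sm p)) (exchange Sm H2 R L1 L2 \<theta> p A))"

definition skeleton_adjointable ::
  "('s, 'f) cat \<Rightarrow> ('s, 'f, 'o1, 'm1) fibcat \<Rightarrow> ('s, 'f, 'o2, 'm2) fibcat
     \<Rightarrow> ('s \<Rightarrow> ('o1, 'm1, 'o2, 'm2) ftor)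
     \<Rightarrow> ('f \<Rightarrow> ('o1, 'm1, 'o1, 'm1) left_adj) \<Rightarrow> ('f \<Rightarrow> ('o2, 'm2, 'o2, 'm2) left_adj)
     \<Rightarrow> ('f \<Rightarrow> 'o1 \<Rightarrow> 'm2) \<times> ('f \<Rightarrow> 'o1 \<Rightarrow> 'm2) \<Rightarrow> bool" where
  "skeleton_adjointable Sm H1 H2 R L1 L2 = (\<lambda>(\<theta>sm, \<theta>cl). left_adjointable Sm H1 H2 R L1 L2 \<theta>sm)"

end

theory Submission
  imports Defs
begin

text \<open>
  Write \<open>N(f)\<close> for the set of natural isomorphisms \<open>f\<^sup>* R \<rightarrow> R f\<^sup>*\<close>.  For composable \<open>f\<close>, \<open>g\<close>,
  elements \<open>\<alpha>\<close> of \<open>N(f)\<close> and \<open>\<beta>\<close> of \<open>N(g)\<close> paste to an element of \<open>N(g f)\<close>, namely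
  \<open>(gf)\<^sup>* R = f\<^sup>* g\<^sup>* R \<rightarrow> f\<^sup>* R g\<^sup>* \<rightarrow> R f\<^sup>* g\<^sup>* = R (gf)\<^sup>*\<close>.  The cocycle condition on the connection
  isomorphisms makes pasting associative (\<open>paste_assoc_component\<close>), so the pairs \<open>(f, \<alpha>)\<close> behave
  like the arrows of a category over the base.  A structure on the family is then the same as a
  multiplicative section \<open>\<theta>\<close>, that is \<open>\<theta> (g f) = paste f g (\<theta> f) (\<theta> g)\<close>, and the compatibility
  required of a skeleton says that the two ways of pasting along a commutative square agree
  (\<open>is_structure_iff\<close>, \<open>is_skeleton_iff\<close>).  In this language all connection isomorphisms have
  disappeared.  Restricting a section gives a skeleton, since both pastings along a square compute
  the value at its diagonal.

  Conversely, let \<open>\<sigma>\<close> and \<open>\<kappa>\<close> be the sections of a skeleton on smooth morphisms and closed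
  immersions.  An extension must send \<open>f = p t\<close>, with \<open>t\<close> closed and \<open>p\<close> smooth, to the pasting of
  \<open>\<kappa> t\<close> and \<open>\<sigma> p\<close>; this gives uniqueness, and existence has two points.

  \<^item> The value does not depend on the factorization (\<open>factorization_independent\<close>).  Two
    factorizations through \<open>P\<close> and \<open>P'\<close> are both refined by the one through \<open>P \<times>\<^sub>S P'\<close>, whose first
    arrow is closed because its composite with a projection is closed.  That refining by a smooth
    \<open>q\<close> changes nothing is the skeleton condition for the degenerate square \<open>q u = t id\<close>
    (\<open>refine_factorization\<close>).

  \<^item> The value is multiplicative (\<open>glued_mult\<close>).  In \<open>T \<rightarrow> P' \<rightarrow> S \<rightarrow> P \<rightarrow> V\<close> the inner composite, a
    smooth morphism followed by a closed immersion, factors as a closed immersion followed by a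
    smooth morphism, and the skeleton condition for the resulting square exchanges the two.

  Adjointability concerns only the components of a structure at smooth morphisms, and these are
  not changed by passing to the underlying skeleton.
\<close>

section \<open>Arrows, isomorphisms and functors\<close>

lemma homD:
  assumes "f \<in> hom C A B"
  shows "f \<in> Arr C" "Dom C f = A" "Cod C f = B"
  using assms by (auto simp: hom_def)

context category
begin

lemma comp_arr:
  assumes "f \<in> Arr C" "g \<in> Arr C" "Cod C f = Dom C g"
  shows "g \<cdot> f \<in> Arr C" "Dom C (g \<cdot> f) = Dom C f" "Cod C (g \<cdot> f) = Cod C g"
  using Cmp_hom[OF assms] by (auto simp: hom_def)

lemma comp_in_hom:
  assumes "f \<in> hom C A B" "g \<in> hom C B E"
  shows "g \<cdot> f \<in> hom C A E"
  using assms comp_arr by (auto simp: hom_def)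

lemma comp_assoc:
  assumes "f \<in> hom C A B" "g \<in> hom C B D" "h \<in> hom C D E"
  shows "(h \<cdot> g) \<cdot> f = h \<cdot> (g \<cdot> f)"
  using assms Cmp_assoc by (auto simp: hom_def)

lemma comp_ide_left: "f \<in> hom C A B \<Longrightarrow> Ide C B \<cdot> f = f"
  using Ide_left by (auto simp: hom_def)

lemma comp_ide_right: "f \<in> hom C A B \<Longrightarrow> f \<cdot> Ide C A = f"
  using Ide_right by (auto simp: hom_def)

lemma hom_obj:
  assumes "f \<in> hom C A B"
  shows "A \<in> Obj C" "B \<in> Obj C"
  using assms Dom_closed Cod_closed by (auto simp: hom_def)

lemma inverse_arrows_unique:
  assumes "inverse_arrows C f g" "inverse_arrows C f g'"
  shows "g = g'"
proof -
  have f: "f \<in> hom C (Dom C f) (Cod C f)"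
    and g: "g \<in> hom C (Cod C f) (Dom C f)" and g': "g' \<in> hom C (Cod C f) (Dom C f)"
    using assms by (auto simp: inverse_arrows_def hom_def)
  have "g = g \<cdot> (f \<cdot> g')"
    using assms(2) comp_ide_right[OF g] by (simp add: inverse_arrows_def)
  also have "\<dots> = (g \<cdot> f) \<cdot> g'"
    using comp_assoc[OF g' f g] by simp
  also have "\<dots> = g'"
    using assms(1) comp_ide_left[OF g'] by (simp add: inverse_arrows_def)
  finally show ?thesis .
qed

lemma inverse_arrows_inv_arr:
  assumes "iso_arr C f"
  shows "inverse_arrows C f (inv_arr C f)"
  unfolding inv_arr_def
  using assms theI'[of "inverse_arrows C f"] inverse_arrows_unique unfolding iso_arr_def by metis

lemma
  assumes "iso_arr C f" "f \<in> hom C A B"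
  shows inv_in_hom: "inv_arr C f \<in> hom C B A"
    and inv_comp: "inv_arr C f \<cdot> f = Ide C A"
    and comp_inv: "f \<cdot> inv_arr C f = Ide C B"
  using inverse_arrows_inv_arr[OF assms(1)] assms(2) by (auto simp: inverse_arrows_def hom_def)

lemma iso_arr_inv:
  assumes "iso_arr C f"
  shows "iso_arr C (inv_arr C f)"
  using inverse_arrows_inv_arr[OF assms] unfolding iso_arr_def inverse_arrows_def hom_def by auto

lemma iso_arr_ide: "A \<in> Obj C \<Longrightarrow> iso_arr C (Ide C A)"
  using Ide_hom[of A] comp_ide_left[of "Ide C A" A A]
  unfolding iso_arr_def inverse_arrows_def hom_def by auto

lemma inv_comp_cancel:
  assumes "iso_arr C f" "f \<in> hom C A B" "x \<in> hom C X A"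
  shows "inv_arr C f \<cdot> (f \<cdot> x) = x"
  using comp_assoc[OF assms(3,2) inv_in_hom[OF assms(1,2)]] inv_comp[OF assms(1,2)]
    comp_ide_left[OF assms(3)] by simp

lemma comp_inv_cancel:
  assumes "iso_arr C f" "f \<in> hom C A B" "x \<in> hom C X B"
  shows "f \<cdot> (inv_arr C f \<cdot> x) = x"
  using comp_assoc[OF assms(3) inv_in_hom[OF assms(1,2)] assms(2)] comp_inv[OF assms(1,2)]
    comp_ide_left[OF assms(3)] by simp

lemma iso_left_cancel:
  assumes "iso_arr C f" "f \<in> hom C A B" "x \<in> hom C X A" "y \<in> hom C X A" "f \<cdot> x = f \<cdot> y"
  shows "x = y"
  using inv_comp_cancel[OF assms(1,2,3)] inv_comp_cancel[OF assms(1,2,4)] assms(5) by metis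

lemma iso_right_cancel:
  assumes "iso_arr C f" "f \<in> hom C A B" "x \<in> hom C B X" "y \<in> hom C B X" "x \<cdot> f = y \<cdot> f"
  shows "x = y"
proof -
  note i = inv_in_hom[OF assms(1,2)]
  have "x = (x \<cdot> f) \<cdot> inv_arr C f"
    using comp_assoc[OF i assms(2,3)] comp_inv[OF assms(1,2)] comp_ide_right[OF assms(3)] by simp
  also have "\<dots> = y"
    using comp_assoc[OF i assms(2,4)] comp_inv[OF assms(1,2)] comp_ide_right[OF assms(4)] assms(5)
    by simp
  finally show ?thesis .
qed

lemma iso_arr_comp:
  assumes "iso_arr C f" "iso_arr C g" "f \<in> hom C A B" "g \<in> hom C B D"
  shows "iso_arr C (g \<cdot> f)"
proof -
  note f' = inv_in_hom[OF assms(1,3)] and g' = inv_in_hom[OF assms(2,4)]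
  have "(inv_arr C f \<cdot> inv_arr C g) \<cdot> (g \<cdot> f) = Ide C A"
    using comp_assoc[OF comp_in_hom[OF assms(3,4)] g' f'] inv_comp_cancel[OF assms(2,4,3)]
      inv_comp[OF assms(1,3)] by simp
  moreover have "(g \<cdot> f) \<cdot> (inv_arr C f \<cdot> inv_arr C g) = Ide C D"
    using comp_assoc[OF comp_in_hom[OF g' f'] assms(3,4)] comp_inv_cancel[OF assms(1,3) g']
      comp_inv[OF assms(2,4)] by simp
  moreover note comp_in_hom[OF assms(3,4)] comp_in_hom[OF g' f']
  ultimately show ?thesis
    unfolding iso_arr_def inverse_arrows_def hom_def by auto
qed

lemma square_stack:
  assumes "b \<in> hom C X Y" "a \<in> hom C Y Z" "b' \<in> hom C X' Y'" "a' \<in> hom C Y' Z'"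
    and "m \<in> hom C X X'" "n \<in> hom C Y Y'" "k \<in> hom C Z Z'"
    and "b' \<cdot> m = n \<cdot> b" "a' \<cdot> n = k \<cdot> a"
  shows "(a' \<cdot> b') \<cdot> m = k \<cdot> (a \<cdot> b)"
  using comp_assoc[OF assms(5,3,4)] comp_assoc[OF assms(1,6,4)] comp_assoc[OF assms(1,2,7)] assms(8,9)
  by simp

lemma square_cancel:
  assumes "iso_arr C c'" "c \<in> hom C Y Z" "c' \<in> hom C Y' Z'" "p \<in> hom C X Y" "p' \<in> hom C X' Y'"
    and "m \<in> hom C X X'" "n \<in> hom C Y Y'" "k \<in> hom C Z Z'"
    and "c' \<cdot> n = k \<cdot> c" "(c' \<cdot> p') \<cdot> m = k \<cdot> (c \<cdot> p)"
  shows "p' \<cdot> m = n \<cdot> p"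
  using iso_left_cancel[OF assms(1,3) comp_in_hom[OF assms(6,5)] comp_in_hom[OF assms(4,7)]]
    comp_assoc[OF assms(6,5,3)] comp_assoc[OF assms(4,7,3)] comp_assoc[OF assms(4,2,8)] assms(9,10)
  by simp

text \<open>
  In applications \<open>c\<close>, \<open>d\<close>, \<open>c'\<close>, \<open>d'\<close> are connection isomorphisms for the two sides of a
  commutative square, and \<open>x\<close>, \<open>y\<close> are the pastings of \<open>u\<close>, \<open>v\<close> along these sides.  The lemma
  translates an equation modulo the identification \<open>q\<^sup>* z\<^sup>* = h\<^sup>* p\<^sup>*\<close> into a plain equation.
\<close>

lemma square_transport_iff:
  assumes iso: "iso_arr C c" "iso_arr C d" "iso_arr C c'" "iso_arr C d'"
    and c: "c \<in> hom C A B" and d: "d \<in> hom C A D"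
    and c': "c' \<in> hom C A' B'" and d': "d' \<in> hom C A' D'"
    and u: "u \<in> hom C B' B" and v: "v \<in> hom C D' D"
    and x: "x \<in> hom C A' A" and y: "y \<in> hom C A' A"
    and eq: "c \<cdot> x = u \<cdot> c'" "d \<cdot> y = v \<cdot> d'"
  shows "(d \<cdot> inv_arr C c) \<cdot> u = v \<cdot> (d' \<cdot> inv_arr C c') \<longleftrightarrow> x = y"
proof -
  note i = inv_in_hom[OF iso(1) c] and i' = inv_in_hom[OF iso(3) c']
  have "inv_arr C c \<cdot> u = inv_arr C c \<cdot> ((u \<cdot> c') \<cdot> inv_arr C c')"
    using comp_assoc[OF i' c' u] comp_inv[OF iso(3) c'] comp_ide_right[OF u] by simp
  also have "\<dots> = x \<cdot> inv_arr C c'"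
    using eq(1) comp_assoc[OF i' x c] inv_comp_cancel[OF iso(1) c comp_in_hom[OF i' x]] by simp
  finally have l: "(d \<cdot> inv_arr C c) \<cdot> u = d \<cdot> (x \<cdot> inv_arr C c')"
    using comp_assoc[OF u i d] by simp
  have r: "v \<cdot> (d' \<cdot> inv_arr C c') = d \<cdot> (y \<cdot> inv_arr C c')"
    using comp_assoc[OF i' d' v] comp_assoc[OF i' y d] eq(2) by simp
  show ?thesis
    unfolding l r
    using iso_left_cancel[OF iso(2) d comp_in_hom[OF i' x] comp_in_hom[OF i' y]]
      iso_right_cancel[OF iso_arr_inv[OF iso(3)] i' x y] by blast
qed

text \<open>
  The diagram chase behind associativity of pasting, with each component replaced by a letter:
  \<open>l\<close>, \<open>l'\<close> stand for the two iterated pastings, \<open>\<mu>\<close>, \<open>y\<close> for the inner ones, \<open>\<alpha>1\<close>, \<open>\<alpha>2\<close> for two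
  components of \<open>\<alpha>\<close>, and the other Latin letters for images of connection isomorphisms.  Both \<open>l\<close> and \<open>l'\<close> become
  \<open>\<alpha>2 \<beta>' \<gamma>'' n m\<close> after composition with \<open>e d = r s\<close>.
\<close>

lemma paste_assoc_diagram:
  assumes iso: "iso_arr C d" "iso_arr C e"
    and hom: "l \<in> hom C X V" "l' \<in> hom C X V"
      "d \<in> hom C V W" "e \<in> hom C W Z" "s \<in> hom C V W'" "r \<in> hom C W' Z"
      "k \<in> hom C X Y" "c'' \<in> hom C Y Q" "m \<in> hom C X Y'" "n \<in> hom C Y' Q"
      "\<gamma>' \<in> hom C Y E" "\<mu> \<in> hom C E W" "c' \<in> hom C E G" "\<gamma>'' \<in> hom C Q G"
      "\<beta>' \<in> hom C G K" "\<alpha>2 \<in> hom C K Z" "y \<in> hom C Y' E'" "w \<in> hom C E' K" "\<alpha>1 \<in> hom C E' W'"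
    and eq: "d \<cdot> l = (\<mu> \<cdot> \<gamma>') \<cdot> k" "e \<cdot> \<mu> = (\<alpha>2 \<cdot> \<beta>') \<cdot> c'" "s \<cdot> l' = (\<alpha>1 \<cdot> y) \<cdot> m"
      "w \<cdot> y = (\<beta>' \<cdot> \<gamma>'') \<cdot> n" "\<alpha>2 \<cdot> w = r \<cdot> \<alpha>1" "c' \<cdot> \<gamma>' = \<gamma>'' \<cdot> c''" "n \<cdot> m = c'' \<cdot> k"
      "r \<cdot> s = e \<cdot> d"
  shows "l = l'"
proof -
  note [simp] = hom[THEN homD(1)] hom[THEN homD(2)] hom[THEN homD(3)] comp_arr
  have "(e \<cdot> d) \<cdot> l = (e \<cdot> \<mu>) \<cdot> (\<gamma>' \<cdot> k)"
    using eq(1) by (simp add: Cmp_assoc)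
  also have "\<dots> = (\<alpha>2 \<cdot> \<beta>') \<cdot> ((c' \<cdot> \<gamma>') \<cdot> k)"
    unfolding eq(2) by (simp add: Cmp_assoc)
  also have "\<dots> = (\<alpha>2 \<cdot> \<beta>') \<cdot> (\<gamma>'' \<cdot> (n \<cdot> m))"
    unfolding eq(6,7) by (simp add: Cmp_assoc)
  also have "\<dots> = \<alpha>2 \<cdot> (((\<beta>' \<cdot> \<gamma>'') \<cdot> n) \<cdot> m)"
    by (simp add: Cmp_assoc)
  also have "\<dots> = (\<alpha>2 \<cdot> w) \<cdot> (y \<cdot> m)"
    unfolding eq(4)[symmetric] by (simp add: Cmp_assoc)
  also have "\<dots> = r \<cdot> ((\<alpha>1 \<cdot> y) \<cdot> m)"
    unfolding eq(5) by (simp add: Cmp_assoc)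
  also have "\<dots> = (r \<cdot> s) \<cdot> l'"
    unfolding eq(3)[symmetric] by (simp add: Cmp_assoc)
  finally have "(e \<cdot> d) \<cdot> l = (e \<cdot> d) \<cdot> l'"
    unfolding eq(8) .
  then show ?thesis
    using iso_left_cancel[OF iso_arr_comp[OF iso hom(3,4)] comp_in_hom[OF hom(3,4)] hom(1,2)] by simp
qed

end

context
  fixes C :: "('o1, 'm1) cat" and D :: "('o2, 'm2) cat" and F
  assumes F: "is_functor C D F"
begin

lemma functor_obj: "A \<in> Obj C \<Longrightarrow> on_obj F A \<in> Obj D"
  using F by (auto simp: is_functor_def)

lemma functor_hom: "a \<in> hom C A B \<Longrightarrow> on_arr F a \<in> hom D (on_obj F A) (on_obj F B)"
  using F by (auto simp: is_functor_def hom_def)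

lemma functor_ide: "A \<in> Obj C \<Longrightarrow> on_arr F (Ide C A) = Ide D (on_obj F A)"
  using F by (auto simp: is_functor_def)

lemma functor_comp:
  "a \<in> hom C A B \<Longrightarrow> b \<in> hom C B E \<Longrightarrow> on_arr F (b \<cdot>\<^bsub>C\<^esub> a) = on_arr F b \<cdot>\<^bsub>D\<^esub> on_arr F a"
  using F by (auto simp: is_functor_def hom_def)

lemma functor_iso:
  assumes "iso_arr C a"
  shows "iso_arr D (on_arr F a)"
proof -
  obtain b where b: "inverse_arrows C a b"
    using assms by (auto simp: iso_arr_def)
  interpret C: category C using F by (simp add: is_functor_def)
  let ?A = "Dom C a" and ?B = "Cod C a"
  have a: "a \<in> hom C ?A ?B" and b': "b \<in> hom C ?B ?A"
    and eq: "b \<cdot>\<^bsub>C\<^esub> a = Ide C ?A" "a \<cdot>\<^bsub>C\<^esub> b = Ide C ?B"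
    using b by (auto simp: inverse_arrows_def hom_def)
  have "on_arr F b \<cdot>\<^bsub>D\<^esub> on_arr F a = Ide D (on_obj F ?A)"
    using functor_comp[OF a b'] functor_ide[OF C.hom_obj(1)[OF a]] eq by simp
  moreover have "on_arr F a \<cdot>\<^bsub>D\<^esub> on_arr F b = Ide D (on_obj F ?B)"
    using functor_comp[OF b' a] functor_ide[OF C.hom_obj(2)[OF a]] eq by simp
  ultimately have "inverse_arrows D (on_arr F a) (on_arr F b)"
    using functor_hom[OF a] functor_hom[OF b'] by (simp add: inverse_arrows_def hom_def)
  then show ?thesis by (auto simp: iso_arr_def)
qed

lemma functor_inv:
  assumes "iso_arr C a" "a \<in> hom C A B"
  shows "on_arr F (inv_arr C a) = inv_arr D (on_arr F a)"
proof -
  interpret C: category C using F by (simp add: is_functor_def)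
  interpret D: category D using F by (simp add: is_functor_def)
  note i = C.inv_in_hom[OF assms] and Fa = functor_hom[OF assms(2)]
  have "on_arr F (inv_arr C a) \<cdot>\<^bsub>D\<^esub> on_arr F a = inv_arr D (on_arr F a) \<cdot>\<^bsub>D\<^esub> on_arr F a"
    using functor_comp[OF assms(2) i] C.inv_comp[OF assms] functor_ide[OF C.hom_obj(1)[OF i]]
      functor_ide[OF C.hom_obj(1)[OF assms(2)]] D.inv_comp[OF functor_iso[OF assms(1)] Fa] by simp
  then show ?thesis
    using D.iso_right_cancel[OF functor_iso[OF assms(1)] Fa functor_hom[OF i]
        D.inv_in_hom[OF functor_iso[OF assms(1)] Fa]] by simp
qed

end

lemma
  assumes "nat_iso C D F G \<tau>" "A \<in> Obj C"
  shows nat_iso_hom: "\<tau> A \<in> hom D (on_obj F A) (on_obj G A)"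
    and nat_iso_iso: "iso_arr D (\<tau> A)"
  using assms by (auto simp: nat_iso_def nat_trans_def)

lemma nat_iso_naturality:
  assumes "nat_iso C D F G \<tau>" "a \<in> hom C A B"
  shows "\<tau> B \<cdot>\<^bsub>D\<^esub> on_arr F a = on_arr G a \<cdot>\<^bsub>D\<^esub> \<tau> A"
  using assms by (auto simp: nat_iso_def nat_trans_def hom_def)

lemma
  assumes "subcategory D C" "f \<in> Arr D"
  shows subcategory_arr: "f \<in> Arr C" "Dom D f = Dom C f" "Cod D f = Cod C f"
  using assms by (auto simp: subcategory_def)

lemma
  assumes "subcategory D C" "g \<in> Arr D" "f \<in> Arr D" "Cod C f = Dom C g"
  shows subcategory_comp: "g \<cdot>\<^bsub>D\<^esub> f = g \<cdot>\<^bsub>C\<^esub> f" "g \<cdot>\<^bsub>C\<^esub> f \<in> Arr D"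
proof -
  have *: "category D" "Cod D f = Dom D g"
    using assms by (auto simp: subcategory_def)
  then show "g \<cdot>\<^bsub>D\<^esub> f = g \<cdot>\<^bsub>C\<^esub> f"
    using assms unfolding subcategory_def by blast
  then show "g \<cdot>\<^bsub>C\<^esub> f \<in> Arr D"
    using category.comp_arr(1)[OF *(1) assms(3,2) *(2)] by simp
qed

lemma cartesian_square_lift:
  assumes "cartesian_square C p f p' f'" "X \<in> Obj C" "u \<in> hom C X (Dom C p)"
    "v \<in> hom C X (Dom C f)" "p \<cdot>\<^bsub>C\<^esub> u = f \<cdot>\<^bsub>C\<^esub> v"
  shows "\<exists>!w. w \<in> hom C X (Dom C p') \<and> f' \<cdot>\<^bsub>C\<^esub> w = u \<and> p' \<cdot>\<^bsub>C\<^esub> w = v"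
  using assms unfolding cartesian_square_def by blast

lemma cartesian_square_sym:
  assumes "cartesian_square C p f p' f'"
  shows "cartesian_square C f p f' p'"
proof -
  have "\<exists>!w. w \<in> hom C X (Dom C f') \<and> p' \<cdot>\<^bsub>C\<^esub> w = u \<and> f' \<cdot>\<^bsub>C\<^esub> w = v"
    if "X \<in> Obj C" "u \<in> hom C X (Dom C f)" "v \<in> hom C X (Dom C p)" "f \<cdot>\<^bsub>C\<^esub> u = p \<cdot>\<^bsub>C\<^esub> v" for X u v
  proof -
    have "\<exists>!w. w \<in> hom C X (Dom C p') \<and> f' \<cdot>\<^bsub>C\<^esub> w = v \<and> p' \<cdot>\<^bsub>C\<^esub> w = u"
      using cartesian_square_lift[OF assms that(1,3,2)] that(4) by simp
    moreover have "Dom C p' = Dom C f'"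
      using assms by (simp add: cartesian_square_def)
    ultimately show ?thesis
      by (simp add: conj_commute)
  qed
  then show ?thesis
    using assms by (simp add: cartesian_square_def)
qed

section \<open>Multiplicative sections over smooth morphisms and closed immersions\<close>

text \<open>
  Think of \<open>N f\<close> as the set of arrows lying over \<open>f\<close>.  In place of identity arrows there is only
  the requirement that an identity carries at most one idempotent; this is enough because the
  value of a multiplicative section at an identity is idempotent.
\<close>

locale category_over = category S for S :: "('s, 'f) cat" (structure) +
  fixes N :: "'f \<Rightarrow> 'a set" and paste :: "'f \<Rightarrow> 'f \<Rightarrow> 'a \<Rightarrow> 'a \<Rightarrow> 'a"
  assumes paste_closed: "f \<in> Arr S \<Longrightarrow> g \<in> Arr S \<Longrightarrow> Cod S f = Dom S g \<Longrightarrow> \<alpha> \<in> N f \<Longrightarrow> \<beta> \<in> N g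
      \<Longrightarrow> paste f g \<alpha> \<beta> \<in> N (g \<cdot> f)"
    and paste_assoc: "f \<in> Arr S \<Longrightarrow> g \<in> Arr S \<Longrightarrow> h \<in> Arr S \<Longrightarrow> Cod S f = Dom S g
      \<Longrightarrow> Cod S g = Dom S h \<Longrightarrow> \<alpha> \<in> N f \<Longrightarrow> \<beta> \<in> N g \<Longrightarrow> \<gamma> \<in> N h
      \<Longrightarrow> paste (g \<cdot> f) h (paste f g \<alpha> \<beta>) \<gamma> = paste f (h \<cdot> g) \<alpha> (paste g h \<beta> \<gamma>)"
    and idempotent_unique: "X \<in> Obj S \<Longrightarrow> \<alpha> \<in> N (Ide S X) \<Longrightarrow> \<beta> \<in> N (Ide S X)
      \<Longrightarrow> paste (Ide S X) (Ide S X) \<alpha> \<alpha> = \<alpha> \<Longrightarrow> paste (Ide S X) (Ide S X) \<beta> \<beta> = \<beta> \<Longrightarrow> \<alpha> = \<beta>"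
begin

definition multiplicative :: "'f set \<Rightarrow> ('f \<Rightarrow> 'a) \<Rightarrow> bool" where
  "multiplicative M \<theta> \<longleftrightarrow> (\<forall>f\<in>M. \<theta> f \<in> N f) \<and>
     (\<forall>f\<in>M. \<forall>g\<in>M. Cod S f = Dom S g \<longrightarrow> \<theta> (g \<cdot> f) = paste f g (\<theta> f) (\<theta> g))"

lemma multiplicativeD:
  assumes "multiplicative M \<theta>"
  shows "f \<in> M \<Longrightarrow> \<theta> f \<in> N f"
    and "f \<in> M \<Longrightarrow> g \<in> M \<Longrightarrow> Cod S f = Dom S g \<Longrightarrow> \<theta> (g \<cdot> f) = paste f g (\<theta> f) (\<theta> g)"
  using assms by (auto simp: multiplicative_def)

end

locale skeleton_over = category_over S N paste
  for S :: "('s, 'f) cat" (structure) and N :: "'f \<Rightarrow> 'a set" and paste +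
  fixes Sm Cl :: "('s, 'f) cat" and \<sigma> \<kappa> :: "'f \<Rightarrow> 'a"
  assumes base: "smooth_closed_base S Sm Cl"
    and \<sigma>: "multiplicative (Arr Sm) \<sigma>"
    and \<kappa>: "multiplicative (Arr Cl) \<kappa>"
    and square: "p \<in> Arr Sm \<Longrightarrow> q \<in> Arr Sm \<Longrightarrow> z \<in> Arr Cl \<Longrightarrow> h \<in> Arr Cl \<Longrightarrow> Cod S h = Dom S p
      \<Longrightarrow> Cod S q = Dom S z \<Longrightarrow> p \<cdot> h = z \<cdot> q \<Longrightarrow> paste q z (\<sigma> q) (\<kappa> z) = paste h p (\<kappa> h) (\<sigma> p)"
begin

lemma smooth_sub: "subcategory Sm S"
  and closed_sub: "subcategory Cl S"
  and iso_smooth_closed: "iso_arr S f \<Longrightarrow> f \<in> Arr Sm \<and> f \<in> Arr Cl"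
  and smooth_pullback: "p \<in> Arr Sm \<Longrightarrow> g \<in> Arr S \<Longrightarrow> Cod S g = Cod S p
    \<Longrightarrow> \<exists>p' g'. cartesian_square S p g p' g'"
  and smooth_base_change: "cartesian_square S p g p' g' \<Longrightarrow> p \<in> Arr Sm \<Longrightarrow> p' \<in> Arr Sm"
  and closed_cancel: "z \<in> Arr S \<Longrightarrow> g \<in> Arr S \<Longrightarrow> Cod S z = Dom S g \<Longrightarrow> g \<cdot> z \<in> Arr Cl
    \<Longrightarrow> z \<in> Arr Cl"
  and factorization_exists: "g \<in> Arr S
    \<Longrightarrow> \<exists>t\<in>Arr Cl. \<exists>p\<in>Arr Sm. Cod S t = Dom S p \<and> g = p \<cdot> t"
  using base unfolding smooth_closed_base_def by blast+

lemma smooth_arr: "p \<in> Arr Sm \<Longrightarrow> p \<in> Arr S"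
  using subcategory_arr(1)[OF smooth_sub] .

lemma closed_arr: "t \<in> Arr Cl \<Longrightarrow> t \<in> Arr S"
  using subcategory_arr(1)[OF closed_sub] .

lemma smooth_comp: "p \<in> Arr Sm \<Longrightarrow> q \<in> Arr Sm \<Longrightarrow> Cod S q = Dom S p \<Longrightarrow> p \<cdot> q \<in> Arr Sm"
  using subcategory_comp(2)[OF smooth_sub] .

lemma closed_comp: "t \<in> Arr Cl \<Longrightarrow> u \<in> Arr Cl \<Longrightarrow> Cod S u = Dom S t \<Longrightarrow> t \<cdot> u \<in> Arr Cl"
  using subcategory_comp(2)[OF closed_sub] .

lemma smooth_ide: "X \<in> Obj S \<Longrightarrow> Ide S X \<in> Arr Sm"
  and closed_ide: "X \<in> Obj S \<Longrightarrow> Ide S X \<in> Arr Cl"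
  using iso_smooth_closed iso_arr_ide by blast+

lemma ide_arr:
  assumes "X \<in> Obj S"
  shows "Ide S X \<in> Arr S" "Dom S (Ide S X) = X" "Cod S (Ide S X) = X"
  using homD[OF Ide_hom[OF assms]] by auto

lemma ide_comp_ide: "X \<in> Obj S \<Longrightarrow> Ide S X \<cdot> Ide S X = Ide S X"
  using Ide_left[of "Ide S X"] ide_arr by simp

lemma sections_agree_ide:
  assumes "X \<in> Obj S"
  shows "\<sigma> (Ide S X) = \<kappa> (Ide S X)"
  using multiplicativeD(1)[OF \<sigma> smooth_ide[OF assms]]
    multiplicativeD(1)[OF \<kappa> closed_ide[OF assms]]
    multiplicativeD(2)[OF \<sigma> smooth_ide smooth_ide, OF assms assms]
    multiplicativeD(2)[OF \<kappa> closed_ide closed_ide, OF assms assms]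
    idempotent_unique[OF assms, of "\<sigma> (Ide S X)" "\<kappa> (Ide S X)"]
  by (simp add: ide_arr[OF assms] ide_comp_ide[OF assms])

text \<open>
  The commutative square with sides \<open>u\<close>, \<open>q\<close> and \<open>id\<close>, \<open>q u\<close> has a smooth side \<open>id\<close>, and \<open>\<sigma>\<close>, \<open>\<kappa>\<close>
  agree there; so the skeleton condition says that \<open>\<kappa> u\<close> and \<open>\<sigma> q\<close> paste to \<open>\<kappa> (q u)\<close>.
\<close>

lemma refine_factorization:
  assumes "p \<in> Arr Sm" "q \<in> Arr Sm" "u \<in> Arr Cl" "q \<cdot> u \<in> Arr Cl"
    and [simp]: "Cod S u = Dom S q" "Cod S q = Dom S p"
  shows "paste u (p \<cdot> q) (\<kappa> u) (\<sigma> (p \<cdot> q)) = paste (q \<cdot> u) p (\<kappa> (q \<cdot> u)) (\<sigma> p)"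
proof -
  let ?t = "q \<cdot> u" and ?i = "Ide S (Dom S u)"
  have arr [simp]: "p \<in> Arr S" "q \<in> Arr S" "u \<in> Arr S"
    using assms smooth_arr closed_arr by auto
  have X: "Dom S u \<in> Obj S"
    using Dom_closed by simp
  have [simp]: "Dom S ?t = Dom S u" "Cod S ?t = Cod S q" "?t \<in> Arr S"
    by (simp_all add: comp_arr)
  have t: "?t \<cdot> ?i = ?t"
    using Ide_right[of ?t] by simp
  have "paste u q (\<kappa> u) (\<sigma> q) = paste ?i ?t (\<sigma> ?i) (\<kappa> ?t)"
    using square[of q ?i ?t u] assms smooth_ide[OF X] t ide_arr[OF X] by simp
  also have "\<dots> = paste ?i ?t (\<kappa> ?i) (\<kappa> ?t)"
    by (simp add: sections_agree_ide[OF X])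
  also have "\<dots> = \<kappa> ?t"
    using multiplicativeD(2)[OF \<kappa>, of ?i ?t] closed_ide[OF X] ide_arr[OF X] assms t by simp
  finally have t: "paste u q (\<kappa> u) (\<sigma> q) = \<kappa> ?t" .
  have "paste u (p \<cdot> q) (\<kappa> u) (\<sigma> (p \<cdot> q)) = paste u (p \<cdot> q) (\<kappa> u) (paste q p (\<sigma> q) (\<sigma> p))"
    using multiplicativeD(2)[OF \<sigma>, of q p] assms by simp
  also have "\<dots> = paste ?t p (paste u q (\<kappa> u) (\<sigma> q)) (\<sigma> p)"
    using paste_assoc[of u q p "\<kappa> u" "\<sigma> q" "\<sigma> p"] assms
      multiplicativeD(1)[OF \<sigma>] multiplicativeD(1)[OF \<kappa>] by simp
  finally show ?thesis
    by (simp add: t)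
qed

text \<open>
  Both factorizations are compared with the one through the fibered product of \<open>p\<close> and \<open>p'\<close>.  The
  arrow \<open>u\<close> into it induced by \<open>t\<close> and \<open>t'\<close> is closed since its composite with a projection is \<open>t\<close>.
\<close>

lemma factorization_independent:
  assumes "t \<in> Arr Cl" "p \<in> Arr Sm" "t' \<in> Arr Cl" "p' \<in> Arr Sm"
    and [simp]: "Cod S t = Dom S p" "Cod S t' = Dom S p'" and eq: "p \<cdot> t = p' \<cdot> t'"
  shows "paste t p (\<kappa> t) (\<sigma> p) = paste t' p' (\<kappa> t') (\<sigma> p')"
proof -
  have [simp]: "t \<in> Arr S" "t' \<in> Arr S" "p \<in> Arr S" "p' \<in> Arr S"
    using assms smooth_arr closed_arr by auto
  have cod: "Cod S p = Cod S p'" and dom: "Dom S t = Dom S t'"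
    using comp_arr[of t p] comp_arr[of t' p'] eq by auto
  obtain q' q where sq: "cartesian_square S p p' q' q"
    using smooth_pullback[OF assms(2), of p'] cod by auto
  have q': "q' \<in> Arr Sm"
    by (rule smooth_base_change[OF sq assms(2)])
  note cartesian_square_sym[OF sq]
  then have q: "q \<in> Arr Sm"
    by (rule smooth_base_change[OF _ assms(4)])
  have s: "Cod S q' = Dom S p'" "Cod S q = Dom S p" "Dom S q' = Dom S q" "p \<cdot> q = p' \<cdot> q'"
    using sq by (auto simp: cartesian_square_def)
  have "t \<in> hom S (Dom S t) (Dom S p)" "t' \<in> hom S (Dom S t) (Dom S p')"
    using dom by (simp_all add: hom_def)
  then have "\<exists>!w. w \<in> hom S (Dom S t) (Dom S q') \<and> q \<cdot> w = t \<and> q' \<cdot> w = t'"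
    using cartesian_square_lift[OF sq Dom_closed[of t]] eq by simp
  then obtain u where u: "u \<in> hom S (Dom S t) (Dom S q')" "q \<cdot> u = t" "q' \<cdot> u = t'"
    by blast
  have uc: "u \<in> Arr Cl"
    using closed_cancel[of u q] u assms(1) q smooth_arr s by (auto simp: hom_def)
  show ?thesis
    using refine_factorization[OF assms(2) q uc] refine_factorization[OF assms(4) q' uc]
      u s assms(1,3) by (auto simp: hom_def)
qed

definition glued :: "'f \<Rightarrow> 'a" where
  "glued f = (SOME \<alpha>. \<exists>t\<in>Arr Cl. \<exists>p\<in>Arr Sm. Cod S t = Dom S p \<and> f = p \<cdot> t
     \<and> \<alpha> = paste t p (\<kappa> t) (\<sigma> p))"

lemma glued_comp:
  assumes "t \<in> Arr Cl" "p \<in> Arr Sm" "Cod S t = Dom S p"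
  shows "glued (p \<cdot> t) = paste t p (\<kappa> t) (\<sigma> p)"
proof -
  have "\<exists>\<alpha>. \<exists>t'\<in>Arr Cl. \<exists>p'\<in>Arr Sm. Cod S t' = Dom S p' \<and> p \<cdot> t = p' \<cdot> t'
      \<and> \<alpha> = paste t' p' (\<kappa> t') (\<sigma> p')"
    using assms by blast
  from someI_ex[OF this] obtain t' p' where "t' \<in> Arr Cl" "p' \<in> Arr Sm" "Cod S t' = Dom S p'"
    "p \<cdot> t = p' \<cdot> t'" "glued (p \<cdot> t) = paste t' p' (\<kappa> t') (\<sigma> p')"
    unfolding glued_def by blast
  then show ?thesis
    using factorization_independent[of t p t' p'] assms by simp
qed

lemma factorization:
  assumes "f \<in> Arr S"
  obtains t p where "t \<in> Arr Cl" "p \<in> Arr Sm" "Cod S t = Dom S p" "f = p \<cdot> t"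
  using factorization_exists[OF assms] by blast

lemma glued_smooth:
  assumes "p \<in> Arr Sm"
  shows "glued p = \<sigma> p"
proof -
  let ?i = "Ide S (Dom S p)"
  have p: "p \<in> Arr S" "Dom S p \<in> Obj S"
    using assms smooth_arr Dom_closed by auto
  have "glued (p \<cdot> ?i) = paste ?i p (\<kappa> ?i) (\<sigma> p)"
    by (intro glued_comp) (simp_all add: assms closed_ide ide_arr p)
  also have "\<dots> = \<sigma> (p \<cdot> ?i)"
    using multiplicativeD(2)[OF \<sigma>, of ?i p] assms p sections_agree_ide[of "Dom S p"]
    by (simp add: smooth_ide ide_arr)
  finally show ?thesis
    using Ide_right p by simp
qed

lemma glued_closed:
  assumes "t \<in> Arr Cl"
  shows "glued t = \<kappa> t"
proof -
  let ?i = "Ide S (Cod S t)"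
  have t: "t \<in> Arr S" "Cod S t \<in> Obj S"
    using assms closed_arr Cod_closed by auto
  have "glued (?i \<cdot> t) = paste t ?i (\<kappa> t) (\<sigma> ?i)"
    by (intro glued_comp) (simp_all add: assms smooth_ide ide_arr t)
  also have "\<dots> = \<kappa> (?i \<cdot> t)"
    using multiplicativeD(2)[OF \<kappa>, of t ?i] assms t sections_agree_ide[of "Cod S t"]
    by (simp add: closed_ide ide_arr)
  finally show ?thesis
    using Ide_left t by simp
qed

lemma glued_in:
  assumes "f \<in> Arr S"
  shows "glued f \<in> N f"
proof -
  obtain t p where "t \<in> Arr Cl" "p \<in> Arr Sm" "Cod S t = Dom S p" "f = p \<cdot> t"
    by (rule factorization[OF assms])
  then show ?thesis
    using glued_comp paste_closed smooth_arr closed_arr multiplicativeD(1)[OF \<sigma>]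
      multiplicativeD(1)[OF \<kappa>] by simp
qed

text \<open>
  With \<open>f = p t\<close>, \<open>g = q u\<close> and \<open>u p = r v\<close>, the composite \<open>g f\<close> has the factorization
  \<open>(q r) (v t)\<close>, and associativity reduces the claim to the square \<open>r v = u p\<close>.
\<close>

lemma glued_mult:
  assumes "f \<in> Arr S" "g \<in> Arr S" "Cod S f = Dom S g"
  shows "glued (g \<cdot> f) = paste f g (glued f) (glued g)"
proof -
  obtain t p where t: "t \<in> Arr Cl" and p: "p \<in> Arr Sm" and [simp]: "Cod S t = Dom S p"
    and f: "f = p \<cdot> t"
    by (rule factorization[OF assms(1)])
  obtain u q where u: "u \<in> Arr Cl" and q: "q \<in> Arr Sm" and [simp]: "Cod S u = Dom S q"
    and g: "g = q \<cdot> u"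
    by (rule factorization[OF assms(2)])
  have [simp]: "t \<in> Arr S" "p \<in> Arr S" "u \<in> Arr S" "q \<in> Arr S"
    using t p u q smooth_arr closed_arr by auto
  have [simp]: "Cod S p = Dom S u"
    using assms(3) f g by (simp add: comp_arr)
  obtain v r where v: "v \<in> Arr Cl" and r: "r \<in> Arr Sm" and [simp]: "Cod S v = Dom S r"
    and vr: "u \<cdot> p = r \<cdot> v"
    by (rule factorization[of "u \<cdot> p"]) (simp_all add: comp_arr)
  have [simp]: "v \<in> Arr S" "r \<in> Arr S"
    using v r smooth_arr closed_arr by auto
  have [simp]: "Dom S v = Dom S p" "Cod S r = Dom S q"
    using comp_arr[of p u] comp_arr[of v r] vr by auto
  note N = multiplicativeD(1)[OF \<kappa>] multiplicativeD(1)[OF \<sigma>] paste_closed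
  have "g \<cdot> f = q \<cdot> (u \<cdot> p) \<cdot> t"
    using f g by (simp add: Cmp_assoc comp_arr)
  also have "\<dots> = q \<cdot> (r \<cdot> v) \<cdot> t"
    by (simp only: vr)
  also have "\<dots> = (q \<cdot> r) \<cdot> (v \<cdot> t)"
    by (simp add: Cmp_assoc comp_arr)
  finally have gf: "g \<cdot> f = (q \<cdot> r) \<cdot> (v \<cdot> t)" .
  have "paste f g (glued f) (glued g)
      = paste (p \<cdot> t) (q \<cdot> u) (paste t p (\<kappa> t) (\<sigma> p)) (paste u q (\<kappa> u) (\<sigma> q))"
    using f g glued_comp t p u q by simp
  also have "\<dots> = paste t ((q \<cdot> u) \<cdot> p) (\<kappa> t) (paste p (q \<cdot> u) (\<sigma> p) (paste u q (\<kappa> u) (\<sigma> q)))"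
    using t p u q by (intro paste_assoc) (simp_all add: comp_arr N)
  also have "paste p (q \<cdot> u) (\<sigma> p) (paste u q (\<kappa> u) (\<sigma> q))
      = paste (u \<cdot> p) q (paste p u (\<sigma> p) (\<kappa> u)) (\<sigma> q)"
    using t p u q by (intro paste_assoc[symmetric]) (simp_all add: comp_arr N)
  \<comment> \<open>the skeleton condition, for the square \<open>r v = u p\<close>\<close>
  also have "paste p u (\<sigma> p) (\<kappa> u) = paste v r (\<kappa> v) (\<sigma> r)"
    using square[of r p u v] p u v r vr by simp
  also have "paste (u \<cdot> p) q (paste v r (\<kappa> v) (\<sigma> r)) (\<sigma> q)
      = paste v (q \<cdot> r) (\<kappa> v) (paste r q (\<sigma> r) (\<sigma> q))"
    unfolding vr using v r q by (intro paste_assoc) (simp_all add: comp_arr N)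
  also have "paste r q (\<sigma> r) (\<sigma> q) = \<sigma> (q \<cdot> r)"
    using multiplicativeD(2)[OF \<sigma>, of r q] q r by simp
  also have "(q \<cdot> u) \<cdot> p = (q \<cdot> r) \<cdot> v"
    using vr by (simp add: Cmp_assoc)
  also have "paste t ((q \<cdot> r) \<cdot> v) (\<kappa> t) (paste v (q \<cdot> r) (\<kappa> v) (\<sigma> (q \<cdot> r)))
      = paste (v \<cdot> t) (q \<cdot> r) (paste t v (\<kappa> t) (\<kappa> v)) (\<sigma> (q \<cdot> r))"
    using t v q r by (intro paste_assoc[symmetric]) (simp_all add: comp_arr N smooth_comp)
  also have "paste t v (\<kappa> t) (\<kappa> v) = \<kappa> (v \<cdot> t)"
    using multiplicativeD(2)[OF \<kappa>, of t v] t v by simp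
  also have "paste (v \<cdot> t) (q \<cdot> r) (\<kappa> (v \<cdot> t)) (\<sigma> (q \<cdot> r)) = glued (g \<cdot> f)"
    unfolding gf using t v q r
    by (intro glued_comp[symmetric]) (simp_all add: comp_arr closed_comp smooth_comp)
  finally show ?thesis ..
qed

lemma glued_multiplicative: "multiplicative (Arr S) glued"
  using glued_in glued_mult by (simp add: multiplicative_def)

lemma extension_unique:
  assumes "multiplicative (Arr S) \<theta>" "\<forall>p\<in>Arr Sm. \<theta> p = \<sigma> p" "\<forall>t\<in>Arr Cl. \<theta> t = \<kappa> t" "f \<in> Arr S"
  shows "\<theta> f = glued f"
proof -
  obtain t p where tp: "t \<in> Arr Cl" "p \<in> Arr Sm" "Cod S t = Dom S p" "f = p \<cdot> t"
    by (rule factorization[OF assms(4)])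
  then have "\<theta> f = paste t p (\<theta> t) (\<theta> p)"
    using multiplicativeD(2)[OF assms(1), of t p] smooth_arr closed_arr by simp
  then show ?thesis
    using tp assms glued_comp by simp
qed

end

section \<open>Exchange transformations and their pasting\<close>

locale fibered_functors = category S + F1: fibered_category S H1 + F2: fibered_category S H2
  for S :: "('s, 'f) cat" (structure)
    and H1 :: "('s, 'f, 'o1, 'm1) fibcat" and H2 :: "('s, 'f, 'o2, 'm2) fibcat" +
  fixes R :: "'s \<Rightarrow> ('o1, 'm1, 'o2, 'm2) ftor"
  assumes R: "functor_family S H1 H2 R"
begin

lemma R_functor: "X \<in> Obj S \<Longrightarrow> is_functor (Fib H1 X) (Fib H2 X) (R X)"
  using R by (simp add: functor_family_def)

text \<open>
  Extensionality makes equality of exchange transformations the same as equality of their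
  components.
\<close>

definition exchanges :: "'f \<Rightarrow> ('o1 \<Rightarrow> 'm2) set" where
  "exchanges f = {\<alpha> \<in> extensional (Obj (Fib H1 (Cod S f))).
     nat_iso (Fib H1 (Cod S f)) (Fib H2 (Dom S f))
       (Pull H2 f \<odot> R (Cod S f)) (R (Dom S f) \<odot> Pull H1 f) \<alpha>}"

text \<open>
  The composite \<open>(gf)\<^sup>* R A \<rightarrow> f\<^sup>* g\<^sup>* R A \<rightarrow> f\<^sup>* R g\<^sup>* A \<rightarrow> R f\<^sup>* g\<^sup>* A \<rightarrow> R (gf)\<^sup>* A\<close>.
\<close>

definition paste :: "'f \<Rightarrow> 'f \<Rightarrow> ('o1 \<Rightarrow> 'm2) \<Rightarrow> ('o1 \<Rightarrow> 'm2) \<Rightarrow> 'o1 \<Rightarrow> 'm2" where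
  "paste f g \<alpha> \<beta> = (\<lambda>A\<in>Obj (Fib H1 (Cod S g)).
     inv_arr (Fib H2 (Dom S f)) (on_arr (R (Dom S f)) (Conn H1 f g A)) \<cdot>\<^bsub>Fib H2 (Dom S f)\<^esub>
     (\<alpha> (on_obj (Pull H1 g) A) \<cdot>\<^bsub>Fib H2 (Dom S f)\<^esub> on_arr (Pull H2 f) (\<beta> A)
        \<cdot>\<^bsub>Fib H2 (Dom S f)\<^esub> Conn H2 f g (on_obj (R (Cod S g)) A)))"

context
  fixes f g
  assumes f [simp]: "f \<in> Arr S" and g [simp]: "g \<in> Arr S" and fg [simp]: "Cod S f = Dom S g"
begin

lemma
  assumes "A \<in> Obj (Fib H1 (Cod S g))"
  shows Conn1_hom: "Conn H1 f g A \<in> hom (Fib H1 (Dom S f))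
      (on_obj (Pull H1 (g \<cdot> f)) A) (on_obj (Pull H1 f) (on_obj (Pull H1 g) A))"
    and Conn1_iso: "iso_arr (Fib H1 (Dom S f)) (Conn H1 f g A)"
  using nat_iso_hom[OF F1.Conn_nat_iso[OF f g fg] assms]
    nat_iso_iso[OF F1.Conn_nat_iso[OF f g fg] assms] by (simp_all add: comp_ftor_def)

lemma
  assumes "A \<in> Obj (Fib H2 (Cod S g))"
  shows Conn2_hom: "Conn H2 f g A \<in> hom (Fib H2 (Dom S f))
      (on_obj (Pull H2 (g \<cdot> f)) A) (on_obj (Pull H2 f) (on_obj (Pull H2 g) A))"
    and Conn2_iso: "iso_arr (Fib H2 (Dom S f)) (Conn H2 f g A)"
  using nat_iso_hom[OF F2.Conn_nat_iso[OF f g fg] assms]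
    nat_iso_iso[OF F2.Conn_nat_iso[OF f g fg] assms] by (simp_all add: comp_ftor_def)

lemma
  assumes "A \<in> Obj (Fib H1 (Cod S g))"
  shows R_Conn_hom: "on_arr (R (Dom S f)) (Conn H1 f g A) \<in> hom (Fib H2 (Dom S f))
      (on_obj (R (Dom S f)) (on_obj (Pull H1 (g \<cdot> f)) A))
      (on_obj (R (Dom S f)) (on_obj (Pull H1 f) (on_obj (Pull H1 g) A)))"
    and R_Conn_iso: "iso_arr (Fib H2 (Dom S f)) (on_arr (R (Dom S f)) (Conn H1 f g A))"
  using functor_hom[OF R_functor Conn1_hom[OF assms]] functor_iso[OF R_functor Conn1_iso[OF assms]]
    Dom_closed[OF f] by auto

end

lemma obj_Pull1:
  "g \<in> Arr S \<Longrightarrow> A \<in> Obj (Fib H1 (Cod S g)) \<Longrightarrow> on_obj (Pull H1 g) A \<in> Obj (Fib H1 (Dom S g))"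
  using functor_obj[OF F1.Pull_functor] by simp

lemma obj_Pull2:
  "g \<in> Arr S \<Longrightarrow> A \<in> Obj (Fib H2 (Cod S g)) \<Longrightarrow> on_obj (Pull H2 g) A \<in> Obj (Fib H2 (Dom S g))"
  using functor_obj[OF F2.Pull_functor] by simp

lemma obj_R: "X \<in> Obj S \<Longrightarrow> A \<in> Obj (Fib H1 X) \<Longrightarrow> on_obj (R X) A \<in> Obj (Fib H2 X)"
  using functor_obj[OF R_functor] by simp

lemma
  assumes "f \<in> Arr S" "\<alpha> \<in> exchanges f" "A \<in> Obj (Fib H1 (Cod S f))"
  shows exchanges_hom: "\<alpha> A \<in> hom (Fib H2 (Dom S f))
      (on_obj (Pull H2 f) (on_obj (R (Cod S f)) A)) (on_obj (R (Dom S f)) (on_obj (Pull H1 f) A))"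
    and exchanges_iso: "iso_arr (Fib H2 (Dom S f)) (\<alpha> A)"
  using assms nat_iso_hom[of _ _ _ _ \<alpha> A] nat_iso_iso[of _ _ _ _ \<alpha> A]
  by (force simp: exchanges_def comp_ftor_def)+

lemma exchanges_naturality:
  assumes "\<alpha> \<in> exchanges f" "a \<in> hom (Fib H1 (Cod S f)) A B"
  shows "\<alpha> B \<cdot>\<^bsub>Fib H2 (Dom S f)\<^esub> on_arr (Pull H2 f) (on_arr (R (Cod S f)) a)
    = on_arr (R (Dom S f)) (on_arr (Pull H1 f) a) \<cdot>\<^bsub>Fib H2 (Dom S f)\<^esub> \<alpha> A"
  using assms nat_iso_naturality[of _ _ _ _ \<alpha> a A B]
  by (force simp: exchanges_def comp_ftor_def)

context
  fixes f g
  assumes f [simp]: "f \<in> Arr S" and g [simp]: "g \<in> Arr S" and fg [simp]: "Cod S f = Dom S g"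
begin

interpretation D1: category "Fib H1 (Cod S g)" using F1.Fib_category Cod_closed g by blast
interpretation D2: category "Fib H2 (Dom S f)" using F2.Fib_category Dom_closed f by blast

context
  fixes \<alpha> \<beta>
  assumes \<alpha>: "\<alpha> \<in> exchanges f" and \<beta>: "\<beta> \<in> exchanges g"
begin

lemma
  assumes A: "A \<in> Obj (Fib H1 (Cod S g))"
  shows paste_left_hom: "\<alpha> (on_obj (Pull H1 g) A) \<in> hom (Fib H2 (Dom S f))
      (on_obj (Pull H2 f) (on_obj (R (Dom S g)) (on_obj (Pull H1 g) A)))
      (on_obj (R (Dom S f)) (on_obj (Pull H1 f) (on_obj (Pull H1 g) A)))"
    and paste_left_iso: "iso_arr (Fib H2 (Dom S f)) (\<alpha> (on_obj (Pull H1 g) A))"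
    and paste_right_hom: "on_arr (Pull H2 f) (\<beta> A) \<in> hom (Fib H2 (Dom S f))
      (on_obj (Pull H2 f) (on_obj (Pull H2 g) (on_obj (R (Cod S g)) A)))
      (on_obj (Pull H2 f) (on_obj (R (Dom S g)) (on_obj (Pull H1 g) A)))"
    and paste_right_iso: "iso_arr (Fib H2 (Dom S f)) (on_arr (Pull H2 f) (\<beta> A))"
  using exchanges_hom[OF f \<alpha>] exchanges_iso[OF f \<alpha>] obj_Pull1[OF g A]
    functor_hom[OF F2.Pull_functor[OF f]] functor_iso[OF F2.Pull_functor[OF f]]
    exchanges_hom[OF g \<beta> A] exchanges_iso[OF g \<beta> A] by auto

lemma
  assumes A: "A \<in> Obj (Fib H1 (Cod S g))"
  shows paste_hom: "paste f g \<alpha> \<beta> A \<in> hom (Fib H2 (Dom S f))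
      (on_obj (Pull H2 (g \<cdot> f)) (on_obj (R (Cod S g)) A))
      (on_obj (R (Dom S f)) (on_obj (Pull H1 (g \<cdot> f)) A))"
    and paste_iso: "iso_arr (Fib H2 (Dom S f)) (paste f g \<alpha> \<beta> A)"
    and paste_eq: "on_arr (R (Dom S f)) (Conn H1 f g A) \<cdot>\<^bsub>Fib H2 (Dom S f)\<^esub> paste f g \<alpha> \<beta> A
      = \<alpha> (on_obj (Pull H1 g) A) \<cdot>\<^bsub>Fib H2 (Dom S f)\<^esub> on_arr (Pull H2 f) (\<beta> A)
        \<cdot>\<^bsub>Fib H2 (Dom S f)\<^esub> Conn H2 f g (on_obj (R (Cod S g)) A)"
proof -
  note a = paste_left_hom[OF A] paste_left_iso[OF A]
    and b = paste_right_hom[OF A] paste_right_iso[OF A]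
    and c2 = Conn2_hom[OF f g fg obj_R[OF Cod_closed[OF g] A]] Conn2_iso[OF f g fg obj_R[OF Cod_closed[OF g] A]]
    and c1 = R_Conn_hom[OF f g fg A] R_Conn_iso[OF f g fg A]
  note ab = D2.comp_in_hom[OF b(1) a(1)] D2.iso_arr_comp[OF b(2) a(2) b(1) a(1)]
  note abc = D2.comp_in_hom[OF c2(1) ab(1)] D2.iso_arr_comp[OF c2(2) ab(2) c2(1) ab(1)]
  note inv = D2.inv_in_hom[OF c1(2,1)] D2.iso_arr_inv[OF c1(2)]
  show "paste f g \<alpha> \<beta> A \<in> hom (Fib H2 (Dom S f))
      (on_obj (Pull H2 (g \<cdot> f)) (on_obj (R (Cod S g)) A))
      (on_obj (R (Dom S f)) (on_obj (Pull H1 (g \<cdot> f)) A))"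
    using D2.comp_in_hom[OF abc(1) inv(1)] A by (simp add: paste_def)
  show "iso_arr (Fib H2 (Dom S f)) (paste f g \<alpha> \<beta> A)"
    using D2.iso_arr_comp[OF abc(2) inv(2) abc(1) inv(1)] A by (simp add: paste_def)
  show "on_arr (R (Dom S f)) (Conn H1 f g A) \<cdot>\<^bsub>Fib H2 (Dom S f)\<^esub> paste f g \<alpha> \<beta> A
      = \<alpha> (on_obj (Pull H1 g) A) \<cdot>\<^bsub>Fib H2 (Dom S f)\<^esub> on_arr (Pull H2 f) (\<beta> A)
        \<cdot>\<^bsub>Fib H2 (Dom S f)\<^esub> Conn H2 f g (on_obj (R (Cod S g)) A)"
    using D2.comp_inv_cancel[OF c1(2,1) abc(1)] A by (simp add: paste_def)
qed

text \<open>
  Together with \<open>paste_eq\<close> this characterizes a pasting by an equation in which no inverse of a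
  connection isomorphism occurs.
\<close>

lemma paste_unique:
  assumes "A \<in> Obj (Fib H1 (Cod S g))"
    and "x \<in> hom (Fib H2 (Dom S f)) (on_obj (Pull H2 (g \<cdot> f)) (on_obj (R (Cod S g)) A))
      (on_obj (R (Dom S f)) (on_obj (Pull H1 (g \<cdot> f)) A))"
    and "on_arr (R (Dom S f)) (Conn H1 f g A) \<cdot>\<^bsub>Fib H2 (Dom S f)\<^esub> x
      = \<alpha> (on_obj (Pull H1 g) A) \<cdot>\<^bsub>Fib H2 (Dom S f)\<^esub> on_arr (Pull H2 f) (\<beta> A)
        \<cdot>\<^bsub>Fib H2 (Dom S f)\<^esub> Conn H2 f g (on_obj (R (Cod S g)) A)"
  shows "x = paste f g \<alpha> \<beta> A"
  using D2.iso_left_cancel[OF R_Conn_iso R_Conn_hom, OF f g fg assms(1) f g fg assms(1,2) paste_hom]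
    paste_eq assms(1,3) by simp

text \<open>
  After composition with the connection isomorphism, the naturality square of a pasting is a stack
  of the naturality squares of the connection isomorphism of \<open>H2\<close>, of \<open>f\<^sup>* \<beta>\<close> and of \<open>\<alpha> g\<^sup>*\<close>.
\<close>

lemma paste_naturality:
  assumes a: "a \<in> hom (Fib H1 (Cod S g)) A B"
  shows "paste f g \<alpha> \<beta> B \<cdot>\<^bsub>Fib H2 (Dom S f)\<^esub> on_arr (Pull H2 (g \<cdot> f)) (on_arr (R (Cod S g)) a)
    = on_arr (R (Dom S f)) (on_arr (Pull H1 (g \<cdot> f)) a) \<cdot>\<^bsub>Fib H2 (Dom S f)\<^esub> paste f g \<alpha> \<beta> A"
proof -
  note A = D1.hom_obj(1)[OF a] and B = D1.hom_obj(2)[OF a]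
  have X: "Dom S f \<in> Obj S" "Dom S g \<in> Obj S" "Cod S g \<in> Obj S"
    using Dom_closed Cod_closed by auto
  have P: "is_functor (Fib H1 (Cod S g)) (Fib H1 (Dom S f)) (Pull H1 (g \<cdot> f))"
    "is_functor (Fib H2 (Cod S g)) (Fib H2 (Dom S f)) (Pull H2 (g \<cdot> f))"
    "is_functor (Fib H1 (Dom S g)) (Fib H1 (Dom S f)) (Pull H1 f)"
    "is_functor (Fib H2 (Dom S g)) (Fib H2 (Dom S f)) (Pull H2 f)"
    "is_functor (Fib H1 (Cod S g)) (Fib H1 (Dom S g)) (Pull H1 g)"
    "is_functor (Fib H2 (Cod S g)) (Fib H2 (Dom S g)) (Pull H2 g)"
    using F1.Pull_functor[of "g \<cdot> f"] F2.Pull_functor[of "g \<cdot> f"] F1.Pull_functor[of f]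
      F2.Pull_functor[of f] F1.Pull_functor[of g] F2.Pull_functor[of g] comp_arr[OF f g fg] by simp_all
  note Ra = functor_hom[OF R_functor[OF X(3)] a] and ga = functor_hom[OF P(5) a]
  note gRa = functor_hom[OF P(6) Ra] and Rga = functor_hom[OF R_functor[OF X(2)] ga]
  note m = functor_hom[OF P(2) Ra] and m' = functor_hom[OF P(4) gRa]
    and m'' = functor_hom[OF P(4) Rga] and k = functor_hom[OF R_functor[OF X(1)] functor_hom[OF P(3) ga]]
    and n = functor_hom[OF R_functor[OF X(1)] functor_hom[OF P(1) a]]
  note b = exchanges_hom[OF g \<beta> A] exchanges_hom[OF g \<beta> B]
  have "Conn H2 f g (on_obj (R (Cod S g)) B) \<cdot>\<^bsub>Fib H2 (Dom S f)\<^esub> on_arr (Pull H2 (g \<cdot> f)) (on_arr (R (Cod S g)) a)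
      = on_arr (Pull H2 f) (on_arr (Pull H2 g) (on_arr (R (Cod S g)) a))
        \<cdot>\<^bsub>Fib H2 (Dom S f)\<^esub> Conn H2 f g (on_obj (R (Cod S g)) A)"
    using nat_iso_naturality[OF F2.Conn_nat_iso[OF f g fg] Ra] by (simp add: comp_ftor_def)
  moreover have "on_arr (Pull H2 f) (\<beta> B) \<cdot>\<^bsub>Fib H2 (Dom S f)\<^esub> on_arr (Pull H2 f) (on_arr (Pull H2 g) (on_arr (R (Cod S g)) a))
      = on_arr (Pull H2 f) (on_arr (R (Dom S g)) (on_arr (Pull H1 g) a))
        \<cdot>\<^bsub>Fib H2 (Dom S f)\<^esub> on_arr (Pull H2 f) (\<beta> A)"
    using exchanges_naturality[OF \<beta> a] functor_comp[OF P(4) gRa b(2)] functor_comp[OF P(4) b(1) Rga]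
    by simp
  moreover have "\<alpha> (on_obj (Pull H1 g) B) \<cdot>\<^bsub>Fib H2 (Dom S f)\<^esub> on_arr (Pull H2 f) (on_arr (R (Dom S g)) (on_arr (Pull H1 g) a))
      = on_arr (R (Dom S f)) (on_arr (Pull H1 f) (on_arr (Pull H1 g) a))
        \<cdot>\<^bsub>Fib H2 (Dom S f)\<^esub> \<alpha> (on_obj (Pull H1 g) A)"
    using exchanges_naturality[OF \<alpha>] ga by simp
  moreover have "on_arr (R (Dom S f)) (Conn H1 f g B) \<cdot>\<^bsub>Fib H2 (Dom S f)\<^esub> on_arr (R (Dom S f)) (on_arr (Pull H1 (g \<cdot> f)) a)
      = on_arr (R (Dom S f)) (on_arr (Pull H1 f) (on_arr (Pull H1 g) a))
        \<cdot>\<^bsub>Fib H2 (Dom S f)\<^esub> on_arr (R (Dom S f)) (Conn H1 f g A)"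
    using nat_iso_naturality[OF F1.Conn_nat_iso[OF f g fg] a]
      functor_comp[OF R_functor[OF X(1)] functor_hom[OF P(1) a] Conn1_hom[OF f g fg B]]
      functor_comp[OF R_functor[OF X(1)] Conn1_hom[OF f g fg A] functor_hom[OF P(3) ga]]
    by (simp add: comp_ftor_def)
  ultimately show ?thesis
    using D2.square_cancel[OF R_Conn_iso[OF f g fg B] R_Conn_hom[OF f g fg A] R_Conn_hom[OF f g fg B]
        paste_hom[OF A] paste_hom[OF B] m n k]
      paste_eq[OF A] paste_eq[OF B]
      D2.square_stack[OF paste_right_hom[OF A] paste_left_hom[OF A] paste_right_hom[OF B]
        paste_left_hom[OF B] m' m'' k]
      D2.square_stack[OF Conn2_hom[OF f g fg obj_R[OF Cod_closed[OF g] A]]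
        D2.comp_in_hom[OF paste_right_hom[OF A] paste_left_hom[OF A]]
        Conn2_hom[OF f g fg obj_R[OF Cod_closed[OF g] B]]
        D2.comp_in_hom[OF paste_right_hom[OF B] paste_left_hom[OF B]] m m' k]
    by simp
qed

lemma paste_exchanges: "paste f g \<alpha> \<beta> \<in> exchanges (g \<cdot> f)"
proof -
  have "paste f g \<alpha> \<beta> \<in> extensional (Obj (Fib H1 (Cod S g)))"
    by (simp add: paste_def)
  then show ?thesis
    using paste_hom paste_iso paste_naturality comp_arr[OF f g fg]
      D1.Dom_closed D1.Cod_closed
    by (auto simp: exchanges_def nat_iso_def nat_trans_def comp_ftor_def hom_def)
qed

end

end

text \<open>
  Pasting is associative by naturality of \<open>\<alpha>\<close> and of the connection isomorphisms of \<open>H2\<close>, together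
  with the cocycle conditions of \<open>H1\<close> (equation \<open>e8\<close>) and of \<open>H2\<close> (equation \<open>e7\<close>).
\<close>

lemma paste_assoc_component:
  assumes f: "f \<in> Arr S" and g: "g \<in> Arr S" and h: "h \<in> Arr S"
    and fg: "Cod S f = Dom S g" and gh: "Cod S g = Dom S h"
    and \<alpha>: "\<alpha> \<in> exchanges f" and \<beta>: "\<beta> \<in> exchanges g" and \<gamma>: "\<gamma> \<in> exchanges h"
    and A: "A \<in> Obj (Fib H1 (Cod S h))"
  shows "paste (g \<cdot> f) h (paste f g \<alpha> \<beta>) \<gamma> A = paste f (h \<cdot> g) \<alpha> (paste g h \<beta> \<gamma>) A"
proof -
  interpret D: category "Fib H2 (Dom S f)" using F2.Fib_category Dom_closed f by blast
  note gf = comp_arr[OF f g fg] and hg = comp_arr[OF g h gh]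
  have gfh: "Cod S (g \<cdot> f) = Dom S h" and fhg: "Cod S f = Dom S (h \<cdot> g)"
    using gf hg fg gh by simp_all
  have eqs: "Dom S (g \<cdot> f) = Dom S f" "Cod S (g \<cdot> f) = Dom S h" "Dom S (h \<cdot> g) = Dom S g"
    "Cod S (h \<cdot> g) = Cod S h" "Cod S f = Dom S g" "Cod S g = Dom S h"
    "h \<cdot> (g \<cdot> f) = (h \<cdot> g) \<cdot> f"
    using gf hg fg gh Cmp_assoc[OF f g h fg gh] by simp_all
  have T: "Dom S f \<in> Obj S" "Dom S g \<in> Obj S" "Cod S g \<in> Obj S" "Cod S h \<in> Obj S"
    using Dom_closed Cod_closed f g h by auto
  have A': "A \<in> Obj (Fib H1 (Cod S (h \<cdot> g)))" using A hg by simp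
  have hA: "on_obj (Pull H1 h) A \<in> Obj (Fib H1 (Cod S g))"
    using obj_Pull1[OF h A] gh by simp
  note RA = obj_R[OF T(4) A]
  have RA': "on_obj (R (Cod S h)) A \<in> Obj (Fib H2 (Cod S (h \<cdot> g)))" using RA hg by simp
  have hRA: "on_obj (Pull H2 h) (on_obj (R (Cod S h)) A) \<in> Obj (Fib H2 (Cod S g))"
    using obj_Pull2[OF h RA] gh by simp
  note RhA = obj_R[OF T(3) hA]
  note PE = paste_exchanges[OF f g fg \<alpha> \<beta>] and QE = paste_exchanges[OF g h gh \<beta> \<gamma>]
  note P1f = F1.Pull_functor[OF f, unfolded fg] and P2f = F2.Pull_functor[OF f, unfolded fg]
    and P2g = F2.Pull_functor[OF g, unfolded gh]
  note RT = R_functor[OF T(1)]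
  note cgh = Conn1_hom[OF g h gh A] and Rcgh = R_Conn_hom[OF g h gh A]
    and Y = paste_hom[OF g h gh \<beta> \<gamma> A] and \<beta>hA = paste_left_hom[OF g h gh \<beta> \<gamma> A]
    and g\<gamma> = paste_right_hom[OF g h gh \<beta> \<gamma> A] and cgh2 = Conn2_hom[OF g h gh RA]
  interpret E: category "Fib H2 (Dom S g)" using F2.Fib_category T by blast
  have "on_arr (Pull H2 f) (on_arr (R (Dom S g)) (Conn H1 g h A) \<cdot>\<^bsub>Fib H2 (Dom S g)\<^esub> paste g h \<beta> \<gamma> A)
    = on_arr (Pull H2 f) (\<beta> (on_obj (Pull H1 h) A) \<cdot>\<^bsub>Fib H2 (Dom S g)\<^esub> on_arr (Pull H2 g) (\<gamma> A)
      \<cdot>\<^bsub>Fib H2 (Dom S g)\<^esub> Conn H2 g h (on_obj (R (Cod S h)) A))"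
    by (simp only: paste_eq[OF g h gh \<beta> \<gamma> A])
  then have e4: "on_arr (Pull H2 f) (on_arr (R (Dom S g)) (Conn H1 g h A)) \<cdot>\<^bsub>Fib H2 (Dom S f)\<^esub>
      on_arr (Pull H2 f) (paste g h \<beta> \<gamma> A)
    = on_arr (Pull H2 f) (\<beta> (on_obj (Pull H1 h) A)) \<cdot>\<^bsub>Fib H2 (Dom S f)\<^esub>
      on_arr (Pull H2 f) (on_arr (Pull H2 g) (\<gamma> A)) \<cdot>\<^bsub>Fib H2 (Dom S f)\<^esub>
      on_arr (Pull H2 f) (Conn H2 g h (on_obj (R (Cod S h)) A))"
    by (simp only: functor_comp[OF P2f Y Rcgh] functor_comp[OF P2f cgh2 E.comp_in_hom[OF g\<gamma> \<beta>hA]]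
        functor_comp[OF P2f g\<gamma> \<beta>hA])
  have e5: "\<alpha> (on_obj (Pull H1 g) (on_obj (Pull H1 h) A)) \<cdot>\<^bsub>Fib H2 (Dom S f)\<^esub>
      on_arr (Pull H2 f) (on_arr (R (Dom S g)) (Conn H1 g h A))
    = on_arr (R (Dom S f)) (on_arr (Pull H1 f) (Conn H1 g h A)) \<cdot>\<^bsub>Fib H2 (Dom S f)\<^esub>
      \<alpha> (on_obj (Pull H1 (h \<cdot> g)) A)"
    using exchanges_naturality[OF \<alpha>, unfolded fg, OF cgh] .
  have e6: "Conn H2 f g (on_obj (R (Dom S h)) (on_obj (Pull H1 h) A)) \<cdot>\<^bsub>Fib H2 (Dom S f)\<^esub>
      on_arr (Pull H2 (g \<cdot> f)) (\<gamma> A)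
    = on_arr (Pull H2 f) (on_arr (Pull H2 g) (\<gamma> A)) \<cdot>\<^bsub>Fib H2 (Dom S f)\<^esub>
      Conn H2 f g (on_obj (Pull H2 h) (on_obj (R (Cod S h)) A))"
    using nat_iso_naturality[OF F2.Conn_nat_iso[OF f g fg, unfolded gh] exchanges_hom[OF h \<gamma> A]]
    by (simp add: comp_ftor_def)
  note e7 = F2.Conn_cocycle[OF f g h fg gh RA]
  have e8: "on_arr (R (Dom S f)) (on_arr (Pull H1 f) (Conn H1 g h A)) \<cdot>\<^bsub>Fib H2 (Dom S f)\<^esub>
      on_arr (R (Dom S f)) (Conn H1 f (h \<cdot> g) A)
    = on_arr (R (Dom S f)) (Conn H1 f g (on_obj (Pull H1 h) A)) \<cdot>\<^bsub>Fib H2 (Dom S f)\<^esub>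
      on_arr (R (Dom S f)) (Conn H1 (g \<cdot> f) h A)"
    using F1.Conn_cocycle[OF f g h fg gh A]
      functor_comp[OF RT Conn1_hom[OF f hg(1) fhg A'] functor_hom[OF P1f cgh]]
      functor_comp[OF RT Conn1_hom[OF gf(1) h gfh A, unfolded eqs] Conn1_hom[OF f g fg hA, unfolded eqs]]
    by simp
  show ?thesis
    by (rule D.paste_assoc_diagram[OF
      R_Conn_iso[OF gf(1) h gfh A, unfolded eqs] R_Conn_iso[OF f g fg hA, unfolded eqs]
      paste_hom[OF gf(1) h gfh PE \<gamma> A, unfolded eqs] paste_hom[OF f hg(1) fhg \<alpha> QE A', unfolded eqs]
      R_Conn_hom[OF gf(1) h gfh A, unfolded eqs] R_Conn_hom[OF f g fg hA, unfolded eqs]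
      R_Conn_hom[OF f hg(1) fhg A', unfolded eqs]
      functor_hom[OF RT functor_hom[OF P1f cgh], unfolded eqs]
      Conn2_hom[OF gf(1) h gfh RA, unfolded eqs] Conn2_hom[OF f g fg hRA, unfolded eqs]
      Conn2_hom[OF f hg(1) fhg RA', unfolded eqs] functor_hom[OF P2f cgh2, unfolded eqs]
      paste_right_hom[OF gf(1) h gfh PE \<gamma> A, unfolded eqs] paste_hom[OF f g fg \<alpha> \<beta> hA, unfolded eqs]
      Conn2_hom[OF f g fg RhA, unfolded eqs]
      functor_hom[OF P2f functor_hom[OF P2g exchanges_hom[OF h \<gamma> A]]]
      paste_right_hom[OF f g fg \<alpha> \<beta> hA, unfolded eqs] paste_left_hom[OF f g fg \<alpha> \<beta> hA, unfolded eqs]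
      paste_right_hom[OF f hg(1) fhg \<alpha> QE A', unfolded eqs] functor_hom[OF P2f Rcgh, unfolded eqs]
      paste_left_hom[OF f hg(1) fhg \<alpha> QE A', unfolded eqs]
      paste_eq[OF gf(1) h gfh PE \<gamma> A, unfolded eqs] paste_eq[OF f g fg \<alpha> \<beta> hA, unfolded eqs]
      paste_eq[OF f hg(1) fhg \<alpha> QE A', unfolded eqs]
      e4[unfolded eqs] e5[unfolded eqs] e6[unfolded eqs] e7[unfolded eqs] e8[unfolded eqs]])
qed

lemma exchanges_eqI:
  assumes "\<alpha> \<in> exchanges f" "\<beta> \<in> exchanges f" "\<And>A. A \<in> Obj (Fib H1 (Cod S f)) \<Longrightarrow> \<alpha> A = \<beta> A"
  shows "\<alpha> = \<beta>"
  using assms by (intro extensionalityI[of \<alpha> "Obj (Fib H1 (Cod S f))"]) (auto simp: exchanges_def)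

text \<open>
  The connection isomorphism of two identities may be a nontrivial automorphism \<open>c\<close> of \<open>A\<close>, hence
  an idempotent \<open>\<alpha>\<close> over an identity need not consist of identity arrows.  Idempotency reads
  \<open>R(c) \<alpha> = \<alpha> \<alpha> c'\<close>, and naturality of \<open>\<alpha>\<close> along \<open>c\<close> turns the left-hand side into \<open>\<alpha> R(c)\<close>;
  cancelling \<open>\<alpha>\<close> determines it in terms of \<open>c\<close> and \<open>c'\<close>.
\<close>

lemma idempotent_component:
  assumes X: "X \<in> Obj S" and \<alpha>: "\<alpha> \<in> exchanges (Ide S X)" and A: "A \<in> Obj (Fib H1 X)"
    and idem: "paste (Ide S X) (Ide S X) \<alpha> \<alpha> = \<alpha>"
  shows "on_arr (R X) (Conn H1 (Ide S X) (Ide S X) A)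
    = \<alpha> A \<cdot>\<^bsub>Fib H2 X\<^esub> Conn H2 (Ide S X) (Ide S X) (on_obj (R X) A)"
    and "\<alpha> A \<in> hom (Fib H2 X) (on_obj (R X) A) (on_obj (R X) A)"
proof -
  let ?i = "Ide S X" and ?D = "Fib H2 X"
  let ?c = "Conn H1 ?i ?i A" and ?c' = "Conn H2 ?i ?i (on_obj (R X) A)"
  interpret D: category ?D using F2.Fib_category X by blast
  have i: "?i \<in> Arr S" "Dom S ?i = X" "Cod S ?i = X"
    using homD[OF Ide_hom[OF X]] by auto
  have ii: "Cod S ?i = Dom S ?i" "?i \<cdot> ?i = ?i"
    using i Ide_left[OF i(1)] by auto
  have A': "A \<in> Obj (Fib H1 (Cod S ?i))" using A i by simp
  note RA = obj_R[OF X A]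
  have RA': "on_obj (R X) A \<in> Obj (Fib H2 (Cod S ?i))" using RA i by simp
  have c: "?c \<in> hom (Fib H1 X) A A"
    using Conn1_hom[OF i(1,1) ii(1) A'] by (simp add: i ii F1.Pull_Ide_obj X A)
  have c': "?c' \<in> hom ?D (on_obj (R X) A) (on_obj (R X) A)"
    using Conn2_hom[OF i(1,1) ii(1) RA'] by (simp add: i ii F2.Pull_Ide_obj X RA)
  show \<alpha>A: "\<alpha> A \<in> hom ?D (on_obj (R X) A) (on_obj (R X) A)"
    using exchanges_hom[OF i(1) \<alpha> A'] by (simp add: i F1.Pull_Ide_obj F2.Pull_Ide_obj X A RA)
  have \<alpha>_iso: "iso_arr ?D (\<alpha> A)"
    using exchanges_iso[OF i(1) \<alpha> A'] by (simp add: i)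
  note Rc = functor_hom[OF R_functor[OF X] c]
  have "\<alpha> A \<cdot>\<^bsub>?D\<^esub> on_arr (R X) ?c = on_arr (R X) ?c \<cdot>\<^bsub>?D\<^esub> \<alpha> A"
    using exchanges_naturality[OF \<alpha>, of ?c A A] c
    by (simp add: i F1.Pull_Ide_arr F2.Pull_Ide_arr X homD(1)[OF c] homD(1)[OF Rc])
  also have "\<dots> = (\<alpha> A \<cdot>\<^bsub>?D\<^esub> \<alpha> A) \<cdot>\<^bsub>?D\<^esub> ?c'"
    using paste_eq[OF i(1,1) ii(1) \<alpha> \<alpha> A']
    by (simp add: idem i F1.Pull_Ide_obj F2.Pull_Ide_arr X A homD(1)[OF \<alpha>A])
  also have "\<dots> = \<alpha> A \<cdot>\<^bsub>?D\<^esub> (\<alpha> A \<cdot>\<^bsub>?D\<^esub> ?c')"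
    by (rule D.comp_assoc[OF c' \<alpha>A \<alpha>A])
  finally show "on_arr (R X) ?c = \<alpha> A \<cdot>\<^bsub>?D\<^esub> ?c'"
    by (rule D.iso_left_cancel[OF \<alpha>_iso \<alpha>A Rc D.comp_in_hom[OF c' \<alpha>A]])
qed

sublocale category_over S exchanges paste
proof
  fix f g \<alpha> \<beta>
  assume "f \<in> Arr S" "g \<in> Arr S" "Cod S f = Dom S g" "\<alpha> \<in> exchanges f" "\<beta> \<in> exchanges g"
  then show "paste f g \<alpha> \<beta> \<in> exchanges (g \<cdot> f)"
    by (rule paste_exchanges)
next
  fix f g h \<alpha> \<beta> \<gamma>
  assume *: "f \<in> Arr S" "g \<in> Arr S" "h \<in> Arr S" "Cod S f = Dom S g" "Cod S g = Dom S h"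
    "\<alpha> \<in> exchanges f" "\<beta> \<in> exchanges g" "\<gamma> \<in> exchanges h"
  then show "paste (g \<cdot> f) h (paste f g \<alpha> \<beta>) \<gamma> = paste f (h \<cdot> g) \<alpha> (paste g h \<beta> \<gamma>)"
    using paste_assoc_component[OF *] comp_arr(3)[of g h]
    by (intro extensionalityI[of _ "Obj (Fib H1 (Cod S h))"]) (simp_all add: paste_def)
next
  fix X \<alpha> \<beta>
  assume X: "X \<in> Obj S"
    and *: "\<alpha> \<in> exchanges (Ide S X)" "\<beta> \<in> exchanges (Ide S X)"
      "paste (Ide S X) (Ide S X) \<alpha> \<alpha> = \<alpha>" "paste (Ide S X) (Ide S X) \<beta> \<beta> = \<beta>"
  let ?i = "Ide S X"
  interpret D: category "Fib H2 X" using F2.Fib_category X by blast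
  have i: "?i \<in> Arr S" "Dom S ?i = X" "Cod S ?i = X"
    using homD[OF Ide_hom[OF X]] by auto
  have ii: "Cod S ?i = Dom S ?i" "?i \<cdot> ?i = ?i"
    using i Ide_left[OF i(1)] by auto
  show "\<alpha> = \<beta>"
  proof (rule exchanges_eqI[OF *(1,2)])
    fix A assume "A \<in> Obj (Fib H1 (Cod S ?i))"
    then have A: "A \<in> Obj (Fib H1 X)" using i by simp
    note RA = obj_R[OF X A]
    have RA': "on_obj (R X) A \<in> Obj (Fib H2 (Cod S ?i))" using RA i by simp
    have c': "Conn H2 ?i ?i (on_obj (R X) A) \<in> hom (Fib H2 X) (on_obj (R X) A) (on_obj (R X) A)"
      and iso: "iso_arr (Fib H2 X) (Conn H2 ?i ?i (on_obj (R X) A))"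
      using Conn2_hom[OF i(1,1) ii(1) RA'] Conn2_iso[OF i(1,1) ii(1) RA']
      by (simp_all add: i ii F2.Pull_Ide_obj X RA)
    show "\<alpha> A = \<beta> A"
      using D.iso_right_cancel[OF iso c'] idempotent_component[OF X *(1) A *(3)]
        idempotent_component[OF X *(2) A *(4)] by simp
  qed
qed

lemma paste_iff:
  assumes f: "f \<in> Arr S" and g: "g \<in> Arr S" and fg: "Cod S f = Dom S g"
    and \<alpha>: "\<alpha> \<in> exchanges f" and \<beta>: "\<beta> \<in> exchanges g" and \<gamma>: "\<gamma> \<in> exchanges (g \<cdot> f)"
  shows "\<gamma> = paste f g \<alpha> \<beta> \<longleftrightarrow> (\<forall>A\<in>Obj (Fib H1 (Cod S g)).
    on_arr (R (Dom S f)) (Conn H1 f g A) \<cdot>\<^bsub>Fib H2 (Dom S f)\<^esub> \<gamma> A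
    = \<alpha> (on_obj (Pull H1 g) A) \<cdot>\<^bsub>Fib H2 (Dom S f)\<^esub> on_arr (Pull H2 f) (\<beta> A)
      \<cdot>\<^bsub>Fib H2 (Dom S f)\<^esub> Conn H2 f g (on_obj (R (Cod S g)) A))" (is "_ \<longleftrightarrow> ?R")
proof
  assume "\<gamma> = paste f g \<alpha> \<beta>"
  then show ?R
    using paste_eq[OF f g fg \<alpha> \<beta>] by simp
next
  note gf = comp_arr[OF f g fg]
  assume ?R
  then show "\<gamma> = paste f g \<alpha> \<beta>"
    using exchanges_hom[OF gf(1) \<gamma>] gf(2,3)
    by (intro exchanges_eqI[OF \<gamma> paste_exchanges[OF f g fg \<alpha> \<beta>]]
        paste_unique[OF f g fg \<alpha> \<beta>]) simp_all
qed

lemma is_structure_iff: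
  assumes S': "subcategory S' S"
  shows "is_structure S' H1 H2 R \<theta> \<longleftrightarrow> \<theta> \<in> extensional (Arr S') \<and> multiplicative (Arr S') \<theta>"
proof -
  note sub = subcategory_arr[OF S'] subcategory_comp[OF S']
  have comp: "(\<theta> (g \<cdot> f) = paste f g (\<theta> f) (\<theta> g)) \<longleftrightarrow>
      (\<forall>A\<in>Obj (Fib H1 (Cod S' g)).
           on_arr (R (Dom S' f)) (Conn H1 f g A) \<cdot>\<^bsub>Fib H2 (Dom S' f)\<^esub> \<theta> (g \<cdot>\<^bsub>S'\<^esub> f) A
           = \<theta> f (on_obj (Pull H1 g) A) \<cdot>\<^bsub>Fib H2 (Dom S' f)\<^esub> on_arr (Pull H2 f) (\<theta> g A)
               \<cdot>\<^bsub>Fib H2 (Dom S' f)\<^esub> Conn H2 f g (on_obj (R (Cod S' g)) A))"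
    if "f \<in> Arr S'" "g \<in> Arr S'" "Cod S' f = Dom S' g" "\<forall>f\<in>Arr S'. \<theta> f \<in> exchanges f" for f g
    using that paste_iff[of f g "\<theta> f" "\<theta> g" "\<theta> (g \<cdot> f)"] sub by simp
  have "is_structure S' H1 H2 R \<theta> \<longleftrightarrow> \<theta> \<in> extensional (Arr S') \<and> (\<forall>f\<in>Arr S'. \<theta> f \<in> exchanges f) \<and>
    (\<forall>f\<in>Arr S'. \<forall>g\<in>Arr S'. Cod S' f = Dom S' g \<longrightarrow>
        (\<forall>A\<in>Obj (Fib H1 (Cod S' g)).
           on_arr (R (Dom S' f)) (Conn H1 f g A) \<cdot>\<^bsub>Fib H2 (Dom S' f)\<^esub> \<theta> (g \<cdot>\<^bsub>S'\<^esub> f) A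
           = \<theta> f (on_obj (Pull H1 g) A) \<cdot>\<^bsub>Fib H2 (Dom S' f)\<^esub> on_arr (Pull H2 f) (\<theta> g A)
               \<cdot>\<^bsub>Fib H2 (Dom S' f)\<^esub> Conn H2 f g (on_obj (R (Cod S' g)) A)))"
    unfolding is_structure_def exchanges_def using sub by auto
  also have "\<dots> \<longleftrightarrow> \<theta> \<in> extensional (Arr S') \<and> multiplicative (Arr S') \<theta>"
    unfolding multiplicative_def
    by (intro conj_cong ball_cong imp_cong refl comp[symmetric]) (simp_all add: sub(2,3))
  finally show ?thesis .
qed

lemma is_structure_restrict:
  assumes S': "subcategory S' S" and \<theta>: "multiplicative (Arr S) \<theta>"
  shows "is_structure S' H1 H2 R (restrict \<theta> (Arr S'))"
proof -
  have "multiplicative (Arr S') (restrict \<theta> (Arr S'))"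
    unfolding multiplicative_def
    using multiplicativeD[OF \<theta>] subcategory_arr(1)[OF S'] subcategory_comp(2)[OF S'] by simp
  then show ?thesis
    by (simp add: is_structure_iff[OF S'])
qed

lemma square_iff:
  assumes p: "p \<in> Arr S" and q: "q \<in> Arr S" and z: "z \<in> Arr S" and h: "h \<in> Arr S"
    and hp: "Cod S h = Dom S p" and qz: "Cod S q = Dom S z" and eq: "p \<cdot> h = z \<cdot> q"
    and \<sigma>p: "\<sigma>p \<in> exchanges p" and \<sigma>q: "\<sigma>q \<in> exchanges q"
    and \<kappa>z: "\<kappa>z \<in> exchanges z" and \<kappa>h: "\<kappa>h \<in> exchanges h"
  shows "paste q z \<sigma>q \<kappa>z = paste h p \<kappa>h \<sigma>p \<longleftrightarrow>
    (\<forall>A\<in>Obj (Fib H1 (Cod S z)).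
       on_arr (R (Dom S q)) (square_conn S H1 q z h p A) \<cdot>\<^bsub>Fib H2 (Dom S q)\<^esub>
         (\<sigma>q (on_obj (Pull H1 z) A) \<cdot>\<^bsub>Fib H2 (Dom S q)\<^esub> on_arr (Pull H2 q) (\<kappa>z A))
       = (\<kappa>h (on_obj (Pull H1 p) A) \<cdot>\<^bsub>Fib H2 (Dom S q)\<^esub> on_arr (Pull H2 h) (\<sigma>p A))
           \<cdot>\<^bsub>Fib H2 (Dom S q)\<^esub> square_conn S H2 q z h p (on_obj (R (Cod S z)) A))"
    (is "_ \<longleftrightarrow> (\<forall>A\<in>_. ?sq A)")
proof -
  interpret D: category "Fib H2 (Dom S q)" using F2.Fib_category Dom_closed q by blast
  interpret D1: category "Fib H1 (Dom S q)" using F1.Fib_category Dom_closed q by blast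
  have d: "Dom S h = Dom S q" and c: "Cod S p = Cod S z"
    using comp_arr[OF h p hp] comp_arr[OF q z qz] eq by simp_all
  note RT = R_functor[OF Dom_closed[OF q]]
  have "?sq A \<longleftrightarrow> paste q z \<sigma>q \<kappa>z A = paste h p \<kappa>h \<sigma>p A" if A: "A \<in> Obj (Fib H1 (Cod S z))" for A
  proof -
    have A': "A \<in> Obj (Fib H1 (Cod S p))" using A c by simp
    note RA = obj_R[OF Cod_closed[OF z] A] and RA' = obj_R[OF Cod_closed[OF p] A']
    note cqz = Conn1_hom[OF q z qz A] and cqz_iso = Conn1_iso[OF q z qz A]
      and chp = Conn1_hom[OF h p hp A', unfolded d eq]
    have "on_arr (R (Dom S q)) (square_conn S H1 q z h p A)
      = on_arr (R (Dom S q)) (Conn H1 h p A) \<cdot>\<^bsub>Fib H2 (Dom S q)\<^esub>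
        inv_arr (Fib H2 (Dom S q)) (on_arr (R (Dom S q)) (Conn H1 q z A))"
      unfolding square_conn_def
      using functor_comp[OF RT D1.inv_in_hom[OF cqz_iso cqz] chp] functor_inv[OF RT cqz_iso cqz]
      by simp
    then show ?thesis
      using D.square_transport_iff[OF R_Conn_iso[OF q z qz A] R_Conn_iso[OF h p hp A', unfolded d eq c]
        Conn2_iso[OF q z qz RA] Conn2_iso[OF h p hp RA', unfolded d eq c]
        R_Conn_hom[OF q z qz A] R_Conn_hom[OF h p hp A', unfolded d eq c]
        Conn2_hom[OF q z qz RA] Conn2_hom[OF h p hp RA', unfolded d eq c]
        D.comp_in_hom[OF paste_right_hom[OF q z qz \<sigma>q \<kappa>z A] paste_left_hom[OF q z qz \<sigma>q \<kappa>z A]]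
        D.comp_in_hom[OF paste_right_hom[OF h p hp \<kappa>h \<sigma>p A', unfolded d eq c]
          paste_left_hom[OF h p hp \<kappa>h \<sigma>p A', unfolded d eq c]]
        paste_hom[OF q z qz \<sigma>q \<kappa>z A] paste_hom[OF h p hp \<kappa>h \<sigma>p A', unfolded d eq c]
        paste_eq[OF q z qz \<sigma>q \<kappa>z A] paste_eq[OF h p hp \<kappa>h \<sigma>p A', unfolded d eq c]]
      by (simp add: square_conn_def)
  qed
  moreover have "paste q z \<sigma>q \<kappa>z = paste h p \<kappa>h \<sigma>p \<longleftrightarrow>
      (\<forall>A\<in>Obj (Fib H1 (Cod S z)). paste q z \<sigma>q \<kappa>z A = paste h p \<kappa>h \<sigma>p A)"
    using exchanges_eqI[OF paste_exchanges[OF q z qz \<sigma>q \<kappa>z]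
        paste_exchanges[OF h p hp \<kappa>h \<sigma>p, unfolded eq]] comp_arr(3)[OF q z qz] by auto
  ultimately show ?thesis by simp
qed

lemma is_skeleton_iff:
  assumes Sm: "subcategory Sm S" and Cl: "subcategory Cl S"
  shows "is_skeleton S Sm Cl H1 H2 R (\<sigma>, \<kappa>) \<longleftrightarrow>
    is_structure Sm H1 H2 R \<sigma> \<and> is_structure Cl H1 H2 R \<kappa> \<and>
    (\<forall>p\<in>Arr Sm. \<forall>q\<in>Arr Sm. \<forall>z\<in>Arr Cl. \<forall>h\<in>Arr Cl.
        Cod S h = Dom S p \<and> Cod S q = Dom S z \<and> p \<cdot> h = z \<cdot> q \<longrightarrow>
        paste q z (\<sigma> q) (\<kappa> z) = paste h p (\<kappa> h) (\<sigma> p))"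
proof -
  have "paste q z (\<sigma> q) (\<kappa> z) = paste h p (\<kappa> h) (\<sigma> p) \<longleftrightarrow>
    (\<forall>A\<in>Obj (Fib H1 (Cod S z)).
       on_arr (R (Dom S q)) (square_conn S H1 q z h p A) \<cdot>\<^bsub>Fib H2 (Dom S q)\<^esub>
         (\<sigma> q (on_obj (Pull H1 z) A) \<cdot>\<^bsub>Fib H2 (Dom S q)\<^esub> on_arr (Pull H2 q) (\<kappa> z A))
       = (\<kappa> h (on_obj (Pull H1 p) A) \<cdot>\<^bsub>Fib H2 (Dom S q)\<^esub> on_arr (Pull H2 h) (\<sigma> p A))
           \<cdot>\<^bsub>Fib H2 (Dom S q)\<^esub> square_conn S H2 q z h p (on_obj (R (Cod S z)) A))"
    if "is_structure Sm H1 H2 R \<sigma>" "is_structure Cl H1 H2 R \<kappa>"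
      "p \<in> Arr Sm" "q \<in> Arr Sm" "z \<in> Arr Cl" "h \<in> Arr Cl"
      "Cod S h = Dom S p" "Cod S q = Dom S z" "p \<cdot> h = z \<cdot> q" for p q z h
    using that is_structure_iff[OF Sm] is_structure_iff[OF Cl] multiplicativeD(1)
      subcategory_arr(1)[OF Sm] subcategory_arr(1)[OF Cl]
    by (intro square_iff) blast+
  then show ?thesis
    unfolding is_skeleton_def by auto
qed

end

theorem proposition2p6:
  fixes S Sm Cl :: "('s, 'f) cat"
    and H1 :: "('s, 'f, 'o1, 'm1) fibcat" and H2 :: "('s, 'f, 'o2, 'm2) fibcat"
    and R :: "'s \<Rightarrow> ('o1, 'm1, 'o2, 'm2) ftor"
  assumes "smooth_closed_base S Sm Cl"
    and "fibered_category S H1" and "fibered_category S H2"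
    and "functor_family S H1 H2 R"
  shows "(\<forall>\<theta>. is_structure S H1 H2 R \<theta> \<longrightarrow>
            is_skeleton S Sm Cl H1 H2 R (restrict \<theta> (Arr Sm), restrict \<theta> (Arr Cl)))
    \<and> (\<forall>\<theta>sm \<theta>cl. is_skeleton S Sm Cl H1 H2 R (\<theta>sm, \<theta>cl) \<longrightarrow>
            (\<exists>!\<theta>. is_structure S H1 H2 R \<theta> \<and>
                  (\<forall>p\<in>Arr Sm. \<theta> p = \<theta>sm p) \<and> (\<forall>t\<in>Arr Cl. \<theta> t = \<theta>cl t)))
    \<and> (\<forall>L1 L2. smooth_adjointable Sm H1 L1 \<and> smooth_adjointable Sm H2 L2 \<longrightarrow>
            (\<forall>\<theta>. is_structure S H1 H2 R \<theta> \<longrightarrow>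
               (left_adjointable Sm H1 H2 R L1 L2 \<theta> \<longleftrightarrow>
                skeleton_adjointable Sm H1 H2 R L1 L2 (restrict \<theta> (Arr Sm), restrict \<theta> (Arr Cl)))))"
proof (intro conjI allI impI)
  interpret F1: fibered_category S H1 by fact
  interpret F2: fibered_category S H2 by fact
  interpret fibered_functors S H1 H2 R by unfold_locales fact
  have Sm: "subcategory Sm S" and Cl: "subcategory Cl S"
    using assms(1) by (auto simp: smooth_closed_base_def)
  have SS: "subcategory S S"
    using fibered_category.axioms(1)[OF assms(2)] by (simp add: subcategory_def)
  {
    fix \<theta>
    assume "is_structure S H1 H2 R \<theta>"
    then have \<theta>: "multiplicative (Arr S) \<theta>"
      using is_structure_iff[OF SS] by simp
    show "is_skeleton S Sm Cl H1 H2 R (restrict \<theta> (Arr Sm), restrict \<theta> (Arr Cl))"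
      unfolding is_skeleton_iff[OF Sm Cl]
    proof (intro conjI ballI impI is_structure_restrict Sm Cl \<theta>)
      fix p q z h
      assume "p \<in> Arr Sm" "q \<in> Arr Sm" "z \<in> Arr Cl" "h \<in> Arr Cl"
        and "Cod S h = Dom S p \<and> Cod S q = Dom S z \<and> p \<cdot>\<^bsub>S\<^esub> h = z \<cdot>\<^bsub>S\<^esub> q"
      then show "paste q z (restrict \<theta> (Arr Sm) q) (restrict \<theta> (Arr Cl) z)
          = paste h p (restrict \<theta> (Arr Cl) h) (restrict \<theta> (Arr Sm) p)"
        using multiplicativeD(2)[OF \<theta>, of q z] multiplicativeD(2)[OF \<theta>, of h p]
          subcategory_arr(1)[OF Sm] subcategory_arr(1)[OF Cl] by simp
    qed
  }
  {
    fix \<sigma> \<kappa>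
    assume sk: "is_skeleton S Sm Cl H1 H2 R (\<sigma>, \<kappa>)"
    interpret K: skeleton_over S exchanges paste Sm Cl \<sigma> \<kappa>
      using assms(1) sk is_structure_iff[OF Sm] is_structure_iff[OF Cl]
      unfolding is_skeleton_iff[OF Sm Cl] by unfold_locales auto
    show "\<exists>!\<theta>. is_structure S H1 H2 R \<theta> \<and> (\<forall>p\<in>Arr Sm. \<theta> p = \<sigma> p) \<and> (\<forall>t\<in>Arr Cl. \<theta> t = \<kappa> t)"
    proof (intro ex1I[of _ "restrict K.glued (Arr S)"] conjI ballI)
      show "is_structure S H1 H2 R (restrict K.glued (Arr S))"
        by (rule is_structure_restrict[OF SS K.glued_multiplicative])
    next
      fix p assume "p \<in> Arr Sm"
      then show "restrict K.glued (Arr S) p = \<sigma> p"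
        using K.glued_smooth K.smooth_arr by simp
    next
      fix t assume "t \<in> Arr Cl"
      then show "restrict K.glued (Arr S) t = \<kappa> t"
        using K.glued_closed K.closed_arr by simp
    next
      fix \<theta>
      assume "is_structure S H1 H2 R \<theta> \<and> (\<forall>p\<in>Arr Sm. \<theta> p = \<sigma> p) \<and> (\<forall>t\<in>Arr Cl. \<theta> t = \<kappa> t)"
      then show "\<theta> = restrict K.glued (Arr S)"
        using K.extension_unique[of \<theta>] is_structure_iff[OF SS, of \<theta>]
        by (intro extensionalityI[of \<theta> "Arr S"]) auto
    qed
  }
  show "left_adjointable Sm H1 H2 R L1 L2 \<theta> \<longleftrightarrow>
      skeleton_adjointable Sm H1 H2 R L1 L2 (restrict \<theta> (Arr Sm), restrict \<theta> (Arr Cl))" for L1 L2 \<theta>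
    by (simp add: left_adjointable_def skeleton_adjointable_def exchange_def)
qed

end
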